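(* Let $M$ be a countable structure (with domain identified with $\omega$) with the Lascar Property, such that $(M,\mathrm{acl}^{\mathrm{g}}_M)$ is a pregeometry, and let $\mathbb{G}_M$ be its canonical geometry. Then the assignment $\pi$, sending $\alpha\in\mathrm{Aut}_{\mathrm{top}}(\mathrm{Aut}(M))$ to the map $\pi(\alpha):\mathbb{G}_M\to\mathbb{G}_M$ given by $\pi(\alpha)(K)=K'$ where $K'$ is the unique element with $\alpha(G_{(K)})=G_{(K')}$, is a well-defined map from $\mathrm{Aut}_{\mathrm{top}}(\mathrm{Aut}(M))$ into $\mathrm{Aut}(\mathbb{G}_M)$. Suppose further that there is a group $H$ with $\mathrm{Aut}(M)\le H\le\mathrm{Sym}(\omega)$ such that for every $g\in\mathrm{Aut}(\mathbb{G}_M)$ there is $\hat g\in H$ satisfying: (1) for every $A\in\mathbf{A}(M)$ and $h\in H$, $h(A)\in\mathbf{A}(M)$, and the map $A\mapsto h(A)$ induces a homomorphism $\phi_H$ from $H$ onto $\mathrm{Aut}(\mathbb{G}_M)$ (namely $\phi_H(h)(K)=h(K)$ for $K\in\mathbb{G}_M$); (2) for every $h\in H$, the map $x\mapsto hxh^{-1}$ is a topological automorphism of $\mathrm{Aut}(M)$; (3) the map $g\mapsto\hat g$ is a homomorphism; (4) $\pi(\hat g(\cdot)\hat g^{-1})=g$. Then $\pi\circ\gamma=\phi_H$, where $\gamma:H\to\mathrm{Aut}_{\mathrm{top}}(\mathrm{Aut}(M))$ is conjugation, $\gamma(h)(x)=hxh^{-1}$; and $\mathrm{Aut}_{\ma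thrm{top}}(\mathrm{Aut}(M))\cong\ker(\pi)\rtimes\mathrm{Aut}(\mathbb{G}_M)$.
   Context: $\mathrm{Aut}(M)$ carries the topology of pointwise convergence; $\mathrm{Aut}_{\mathrm{top}}(\mathrm{Aut}(M))$ is the group of automorphisms of $\mathrm{Aut}(M)$ that are homeomorphisms. For $A\subseteq M$, $G_{(A)}$ and $G_{\{A\}}$ denote the pointwise and setwise stabilizers in $G=\mathrm{Aut}(M)$. $a$ is Galois-algebraic over $A$ if its $G_{(A)}$-orbit is finite; $\mathrm{acl}^{\mathrm{g}}_M(A)$ is the set of such $a$; $\mathbf{A}(M)=\{\mathrm{acl}^{\mathrm{g}}_M(A): A\subseteq M\text{ finite}\}$. $M$ has the Lascar Property if: (i) for all $K,S\in\mathbf{A}(M)$ with $S\not\subseteq K$ there are $g\in G_{(K)}$, $h\in G_{(S)}$ with $g^{-1}hg(S)\ne S$; (ii) for every open subgroup $H\le G$ there is $K\in\mathbf{A}(M)$ with $G_{(K)}\le H\le G_{\{K\}}$. A pregeometry is a set with a closure operator satisfying reflexivity, monotonicity, finite character, idempotency and exchange. The canonical geometry $\mathbb{G}_M$ of $(M,\mathrm{acl}^{\mathrm{g}}_M)$ has universe $\{\mathrm{acl}^{\mathrm{g}}_M(a): a\in M\setminus\mathrm{acl}^{\mathrm{g}}_M(\emptyset)\}$ and closure $\mathrm{cl}(X)=\{K\in\mathbb{G}_M: K\subseteq\mathrm{acl}^{\mathrm{g}}_M(\bigcup X)\}$; $\mathrm{Aut}(\mathbb{G}_M)$ is the group of bijections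 $f$ of $\mathbb{G}_M$ with $f(\mathrm{cl}(X))=\mathrm{cl}(f(X))$ for all $X$. *)

theory Defs
  imports "HOL-Analysis.Analysis" "HOL-Algebra.Coset" "HOL-Algebra.Bij"
begin

section \<open>First-order structures with domain \<open>\<omega>\<close> and their automorphism groups\<close>

text \<open>The symbol sets are explicit so that languages without function symbols or without
  relation symbols are covered, although HOL types are nonempty. Interpretations matter only
  on argument lists of the right length.\<close>

record ('f, 'r) omega_structure =
  fun_syms :: "'f set"
  rel_syms :: "'r set"
  fun_arity :: "'f \<Rightarrow> nat"
  rel_arity :: "'r \<Rightarrow> nat"
  fun_interp :: "'f \<Rightarrow> nat list \<Rightarrow> nat"
  rel_interp :: "'r \<Rightarrow> nat list \<Rightarrow> bool"

abbreviation Sym_omega :: "(nat \<Rightarrow> nat) monoid" where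
  "Sym_omega \<equiv> BijGroup (UNIV :: nat set)"

definition automorphisms :: "('f, 'r) omega_structure \<Rightarrow> (nat \<Rightarrow> nat) set" where
  "automorphisms M = {g. bij g \<and>
     (\<forall>f \<in> fun_syms M. \<forall>xs. length xs = fun_arity M f \<longrightarrow>
        g (fun_interp M f xs) = fun_interp M f (map g xs)) \<and>
     (\<forall>r \<in> rel_syms M. \<forall>xs. length xs = rel_arity M r \<longrightarrow>
        (rel_interp M r (map g xs) \<longleftrightarrow> rel_interp M r xs))}"

definition Aut_str :: "('f, 'r) omega_structure \<Rightarrow> (nat \<Rightarrow> nat) monoid" where
  "Aut_str M = Sym_omega\<lparr>carrier := automorphisms M\<rparr>"

text \<open>The type class topology on \<^typ>\<open>nat \<Rightarrow> nat\<close> is the product topology of the discrete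
  topology on \<^typ>\<open>nat\<close>, i.e. the topology of pointwise convergence.\<close>

definition Aut_topology :: "('f, 'r) omega_structure \<Rightarrow> (nat \<Rightarrow> nat) topology" where
  "Aut_topology M = top_of_set (carrier (Aut_str M))"

definition Aut_top :: "('f, 'r) omega_structure \<Rightarrow> ((nat \<Rightarrow> nat) \<Rightarrow> (nat \<Rightarrow> nat)) monoid" where
  "Aut_top M = (AutoGroup (Aut_str M))
     \<lparr>carrier := {\<alpha> \<in> auto (Aut_str M). homeomorphic_map (Aut_topology M) (Aut_topology M) \<alpha>}\<rparr>"

definition pw_stab :: "('f, 'r) omega_structure \<Rightarrow> nat set \<Rightarrow> (nat \<Rightarrow> nat) set" where
  "pw_stab M A = {g \<in> carrier (Aut_str M). \<forall>a \<in> A. g a = a}"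

definition set_stab :: "('f, 'r) omega_structure \<Rightarrow> nat set \<Rightarrow> (nat \<Rightarrow> nat) set" where
  "set_stab M A = {g \<in> carrier (Aut_str M). g ` A = A}"

section \<open>Galois-algebraic closure and the Lascar Property\<close>

definition acl_g :: "('f, 'r) omega_structure \<Rightarrow> nat set \<Rightarrow> nat set" where
  "acl_g M A = {a. finite {g a | g. g \<in> pw_stab M A}}"

definition acl_sets :: "('f, 'r) omega_structure \<Rightarrow> nat set set" where
  "acl_sets M = {acl_g M A | A. finite A}"

definition Lascar_property :: "('f, 'r) omega_structure \<Rightarrow> bool" where
  "Lascar_property M \<longleftrightarrow>
     (\<forall>K \<in> acl_sets M. \<forall>S \<in> acl_sets M. \<not> S \<subseteq> K \<longrightarrow>
        (\<exists>g \<in> pw_stab M K. \<exists>h \<in> pw_stab M S.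
           (inv\<^bsub>Aut_str M\<^esub> g \<otimes>\<^bsub>Aut_str M\<^esub> h \<otimes>\<^bsub>Aut_str M\<^esub> g) ` S \<noteq> S)) \<and>
     (\<forall>U. subgroup U (Aut_str M) \<and> openin (Aut_topology M) U \<longrightarrow>
        (\<exists>K \<in> acl_sets M. pw_stab M K \<subseteq> U \<and> U \<subseteq> set_stab M K))"

section \<open>Pregeometries and the canonical geometry\<close>

definition pregeometry :: "'a set \<Rightarrow> ('a set \<Rightarrow> 'a set) \<Rightarrow> bool" where
  "pregeometry X c \<longleftrightarrow>
     (\<forall>A. A \<subseteq> X \<longrightarrow> c A \<subseteq> X) \<and>
     (\<forall>A. A \<subseteq> X \<longrightarrow> A \<subseteq> c A) \<and>
     (\<forall>A B. A \<subseteq> B \<and> B \<subseteq> X \<longrightarrow> c A \<subseteq> c B) \<and>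
     (\<forall>A a. A \<subseteq> X \<and> a \<in> c A \<longrightarrow> (\<exists>A0. finite A0 \<and> A0 \<subseteq> A \<and> a \<in> c A0)) \<and>
     (\<forall>A. A \<subseteq> X \<longrightarrow> c (c A) = c A) \<and>
     (\<forall>A a b. A \<subseteq> X \<and> a \<in> X \<and> b \<in> X \<and> a \<in> c (insert b A) - c A \<longrightarrow>
        b \<in> c (insert a A))"

definition geom :: "('f, 'r) omega_structure \<Rightarrow> nat set set" where
  "geom M = {acl_g M {a} | a. a \<notin> acl_g M {}}"

definition geom_cl :: "('f, 'r) omega_structure \<Rightarrow> nat set set \<Rightarrow> nat set set" where
  "geom_cl M X = {K \<in> geom M. K \<subseteq> acl_g M (\<Union>X)}"

definition Aut_geom :: "('f, 'r) omega_structure \<Rightarrow> (nat set \<Rightarrow> nat set) monoid" where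
  "Aut_geom M = (BijGroup (geom M))
     \<lparr>carrier := {f \<in> Bij (geom M). \<forall>X. X \<subseteq> geom M \<longrightarrow> f ` geom_cl M X = geom_cl M (f ` X)}\<rparr>"

section \<open>The maps \<open>\<pi>\<close>, \<open>\<gamma>\<close> and \<open>\<phi>\<^sub>H\<close>\<close>

definition pi_map ::
    "('f, 'r) omega_structure \<Rightarrow> ((nat \<Rightarrow> nat) \<Rightarrow> (nat \<Rightarrow> nat)) \<Rightarrow> nat set \<Rightarrow> nat set" where
  "pi_map M \<alpha> = (\<lambda>K \<in> geom M. THE K'. K' \<in> geom M \<and> \<alpha> ` pw_stab M K = pw_stab M K')"

definition gamma_map ::
    "('f, 'r) omega_structure \<Rightarrow> (nat \<Rightarrow> nat) \<Rightarrow> (nat \<Rightarrow> nat) \<Rightarrow> (nat \<Rightarrow> nat)" where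
  "gamma_map M h = (\<lambda>x \<in> carrier (Aut_str M).
     h \<otimes>\<^bsub>Sym_omega\<^esub> x \<otimes>\<^bsub>Sym_omega\<^esub> inv\<^bsub>Sym_omega\<^esub> h)"

definition phi_map :: "('f, 'r) omega_structure \<Rightarrow> (nat \<Rightarrow> nat) \<Rightarrow> nat set \<Rightarrow> nat set" where
  "phi_map M h = (\<lambda>K \<in> geom M. h ` K)"

section \<open>Semidirect products\<close>

definition semidirect_product ::
    "('a, 'm) monoid_scheme \<Rightarrow> ('b \<Rightarrow> 'a \<Rightarrow> 'a) \<Rightarrow> ('b, 'n) monoid_scheme \<Rightarrow> ('a \<times> 'b) monoid" where
  "semidirect_product N \<theta> Q =
     \<lparr>carrier = carrier N \<times> carrier Q,
      mult = \<lambda>(n, q) (n', q'). (n \<otimes>\<^bsub>N\<^esub> \<theta> q n', q \<otimes>\<^bsub>Q\<^esub> q'),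
      one = (\<one>\<^bsub>N\<^esub>, \<one>\<^bsub>Q\<^esub>)\<rparr>"

text \<open>The action on a normal subgroup \<open>N\<close> of \<open>G\<close> by conjugation along a section \<open>s\<close>.\<close>

definition section_action ::
    "('a, 'm) monoid_scheme \<Rightarrow> 'a set \<Rightarrow> ('b \<Rightarrow> 'a) \<Rightarrow> 'b \<Rightarrow> 'a \<Rightarrow> 'a" where
  "section_action G N s q = (\<lambda>n \<in> N. s q \<otimes>\<^bsub>G\<^esub> n \<otimes>\<^bsub>G\<^esub> inv\<^bsub>G\<^esub> (s q))"

end

theory Submission
  imports Defs
begin

text \<open>By the Lascar Property every open subgroup \<open>U\<close> of \<open>G = Aut(M)\<close> has a unique support: a set
  \<open>K\<close> in \<open>\<^bold>A(M)\<close> with \<open>G\<^sub>(\<^sub>K\<^sub>) \<le> U \<le> G\<^sub>{\<^sub>K\<^sub>}\<close>. An open normal subgroup of \<open>U\<close> has the same support as \<open>U\<close>;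
  this gives a group-theoretic criterion for two open subgroups to have equal supports, and it
  applies to all the groups \<open>G\<^sub>(\<^sub>B\<^sub>)\<close> with \<open>B\<close> finite and \<open>acl(B) = K\<close>, together with \<open>G\<^sub>{\<^sub>K\<^sub>}\<close>. The intersection
  of these groups is \<open>G\<^sub>(\<^sub>K\<^sub>)\<close>, which itself need not be open. So a topological automorphism permutes
  the groups \<open>G\<^sub>(\<^sub>K\<^sub>)\<close>, and it induces an automorphism of the partial order \<open>(\<^bold>A(M), \<subseteq>)\<close>. By exchange
  the points of the canonical geometry are the atoms of this order, and by finite character
  its closure operator is definable from the order.\<close>

section \<open>Automorphism groups and stabilizers\<close>

lemma carrier_Aut_str [simp]: "carrier (Aut_str M) = automorphisms M"
  by (simp add: Aut_str_def)

lemma automorphisms_bij: "g \<in> automorphisms M \<Longrightarrow> bij g"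
  by (simp add: automorphisms_def)

lemma automorphisms_id: "id \<in> automorphisms M"
  by (simp add: automorphisms_def)

lemma automorphisms_comp:
  "\<lbrakk>g \<in> automorphisms M; h \<in> automorphisms M\<rbrakk> \<Longrightarrow> g \<circ> h \<in> automorphisms M"
  by (auto simp: automorphisms_def bij_comp simp flip: map_map)

lemma inv_into_UNIV_bij:
  assumes "bij g"
  shows "g (inv_into UNIV g x) = x" "inv_into UNIV g (g x) = x"
  using assms by (simp_all add: bij_is_surj surj_f_inv_f bij_is_inj)

lemma automorphisms_inv:
  assumes "g \<in> automorphisms M"
  shows "inv_into UNIV g \<in> automorphisms M"
proof -
  have b: "bij g" using assms by (rule automorphisms_bij)
  note gi = inv_into_UNIV_bij [OF b]
  have m: "map g (map (inv_into UNIV g) xs) = xs" for xs :: "nat list"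
    by (induction xs) (simp_all add: gi)
  show ?thesis
    unfolding automorphisms_def
  proof (intro CollectI conjI ballI allI impI)
    show "bij (inv_into UNIV g)" using b by (rule bij_imp_bij_inv)
  next
    fix f and xs :: "nat list" assume "f \<in> fun_syms M" and l: "length xs = fun_arity M f"
    then have "g (fun_interp M f (map (inv_into UNIV g) xs))
        = fun_interp M f (map g (map (inv_into UNIV g) xs))"
      using assms unfolding automorphisms_def by simp
    then show "inv_into UNIV g (fun_interp M f xs) = fun_interp M f (map (inv_into UNIV g) xs)"
      unfolding m by (metis gi(2))
  next
    fix r and xs :: "nat list" assume "r \<in> rel_syms M" and l: "length xs = rel_arity M r"
    then have "rel_interp M r (map g (map (inv_into UNIV g) xs))
        = rel_interp M r (map (inv_into UNIV g) xs)"
      using assms unfolding automorphisms_def by (simp del: map_map)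
    then show "rel_interp M r (map (inv_into UNIV g) xs) = rel_interp M r xs"
      unfolding m by simp
  qed
qed

lemma Sym_omega_carrier: "g \<in> carrier Sym_omega \<longleftrightarrow> bij g"
  by (simp add: BijGroup_def Bij_def extensional_def)

lemma Sym_omega_mult: "\<lbrakk>bij g; bij h\<rbrakk> \<Longrightarrow> g \<otimes>\<^bsub>Sym_omega\<^esub> h = g \<circ> h"
  by (auto simp: BijGroup_def Bij_def extensional_def compose_def)

lemma Sym_omega_one: "\<one>\<^bsub>Sym_omega\<^esub> = id"
  by (auto simp: BijGroup_def)

lemma Sym_omega_inv: "bij g \<Longrightarrow> inv\<^bsub>Sym_omega\<^esub> g = inv_into UNIV g"
  by (intro group.inv_equality [OF group_BijGroup])
     (auto simp: Sym_omega_carrier Sym_omega_mult Sym_omega_one bij_imp_bij_inv bij_is_inj)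

lemma subgroup_automorphisms: "subgroup (automorphisms M) Sym_omega"
  by (rule group.subgroupI [OF group_BijGroup])
     (auto simp: Sym_omega_carrier Sym_omega_mult Sym_omega_inv automorphisms_bij
        automorphisms_inv automorphisms_comp intro: automorphisms_id)

lemma group_Aut_str: "group (Aut_str M)"
  unfolding Aut_str_def
  by (rule subgroup.subgroup_is_group [OF subgroup_automorphisms group_BijGroup])

lemma Aut_str_mult:
  "\<lbrakk>g \<in> automorphisms M; h \<in> automorphisms M\<rbrakk> \<Longrightarrow> g \<otimes>\<^bsub>Aut_str M\<^esub> h = g \<circ> h"
  by (simp add: Aut_str_def Sym_omega_mult automorphisms_bij)

lemma Aut_str_one: "\<one>\<^bsub>Aut_str M\<^esub> = id"
  by (simp add: Aut_str_def Sym_omega_one)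

lemma Aut_str_inv:
  assumes "g \<in> automorphisms M"
  shows "inv\<^bsub>Aut_str M\<^esub> g = inv_into UNIV g"
  using assms
  by (intro group.inv_equality [OF group_Aut_str])
     (auto simp: Aut_str_mult Aut_str_one automorphisms_inv automorphisms_bij bij_is_inj)

lemma subgroup_Aut_strI:
  assumes "U \<subseteq> automorphisms M" "id \<in> U"
    and "\<And>g. g \<in> U \<Longrightarrow> inv_into UNIV g \<in> U"
    and "\<And>g h. \<lbrakk>g \<in> U; h \<in> U\<rbrakk> \<Longrightarrow> g \<circ> h \<in> U"
  shows "subgroup U (Aut_str M)"
proof (rule group.subgroupI [OF group_Aut_str])
  show "inv\<^bsub>Aut_str M\<^esub> g \<in> U" if "g \<in> U" for g
    using that assms by (metis Aut_str_inv subsetD)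
  show "g \<otimes>\<^bsub>Aut_str M\<^esub> h \<in> U" if "g \<in> U" "h \<in> U" for g h
    using that assms by (metis Aut_str_mult subsetD)
qed (use assms in auto)

lemma subgroup_Aut_strD:
  assumes "subgroup U (Aut_str M)"
  shows "U \<subseteq> automorphisms M"
    and "g \<in> U \<Longrightarrow> inv_into UNIV g \<in> U"
    and "\<lbrakk>g \<in> U; h \<in> U\<rbrakk> \<Longrightarrow> g \<circ> h \<in> U"
proof -
  show s: "U \<subseteq> automorphisms M"
    using subgroup.subset [OF assms] by simp
  show "g \<in> U \<Longrightarrow> inv_into UNIV g \<in> U"
    using subgroup.m_inv_closed [OF assms] s by (metis Aut_str_inv subsetD)
  show "\<lbrakk>g \<in> U; h \<in> U\<rbrakk> \<Longrightarrow> g \<circ> h \<in> U"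
    using subgroup.m_closed [OF assms] s by (metis Aut_str_mult subsetD)
qed

lemma pw_stab_iff: "g \<in> pw_stab M A \<longleftrightarrow> g \<in> automorphisms M \<and> (\<forall>a\<in>A. g a = a)"
  by (simp add: pw_stab_def)

lemma set_stab_iff: "g \<in> set_stab M A \<longleftrightarrow> g \<in> automorphisms M \<and> g ` A = A"
  by (simp add: set_stab_def)

lemma pw_stab_antimono: "A \<subseteq> B \<Longrightarrow> pw_stab M B \<subseteq> pw_stab M A"
  unfolding pw_stab_iff subset_iff by blast

lemma pw_stab_subset_set_stab: "pw_stab M A \<subseteq> set_stab M A"
  by (auto simp: pw_stab_iff set_stab_iff)

lemma subgroup_pw_stab: "subgroup (pw_stab M A) (Aut_str M)"
proof (rule subgroup_Aut_strI)
  show "inv_into UNIV g \<in> pw_stab M A" if "g \<in> pw_stab M A" for g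
    using that automorphisms_inv [of g M] inv_into_UNIV_bij(2) [OF automorphisms_bij, of g M]
    by (metis pw_stab_iff)
qed (auto simp: pw_stab_iff automorphisms_id automorphisms_comp)

lemma subgroup_set_stab: "subgroup (set_stab M A) (Aut_str M)"
proof (rule subgroup_Aut_strI)
  show "inv_into UNIV g \<in> set_stab M A" if "g \<in> set_stab M A" for g
    using that automorphisms_inv [of g M] automorphisms_bij [of g M]
    by (metis set_stab_iff bij_is_inj image_inv_f_f)
  show "g \<circ> h \<in> set_stab M A" if "g \<in> set_stab M A" "h \<in> set_stab M A" for g h
    using that by (metis set_stab_iff automorphisms_comp image_comp)
qed (auto simp: set_stab_iff automorphisms_id)

text \<open>The permutation \<open>h\<close> is taken to normalize \<open>automorphisms M\<close>
  rather than to lie in it, so that the lemma serves both automorphisms of \<open>M\<close> and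
  elements of the larger group \<open>H\<close>.\<close>

lemma pw_stab_conj:
  assumes "bij h" and conj: "\<And>x. x \<in> automorphisms M \<longleftrightarrow> h \<circ> x \<circ> inv_into UNIV h \<in> automorphisms M"
  shows "(\<lambda>x. h \<circ> x \<circ> inv_into UNIV h) ` pw_stab M A = pw_stab M (h ` A)"
proof
  note hi = inv_into_UNIV_bij [OF assms(1)]
  show "(\<lambda>x. h \<circ> x \<circ> inv_into UNIV h) ` pw_stab M A \<subseteq> pw_stab M (h ` A)"
    using conj by (auto simp: pw_stab_iff hi)
  show "pw_stab M (h ` A) \<subseteq> (\<lambda>x. h \<circ> x \<circ> inv_into UNIV h) ` pw_stab M A"
  proof
    fix y assume y: "y \<in> pw_stab M (h ` A)"
    let ?x = "inv_into UNIV h \<circ> y \<circ> h"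
    have e: "y = h \<circ> ?x \<circ> inv_into UNIV h" by (auto simp: hi)
    have "?x \<in> pw_stab M A"
      using y conj [of ?x] e by (auto simp: pw_stab_iff hi)
    with e show "y \<in> (\<lambda>x. h \<circ> x \<circ> inv_into UNIV h) ` pw_stab M A" by blast
  qed
qed

lemma automorphisms_conj_iff:
  assumes "g \<in> automorphisms M"
  shows "x \<in> automorphisms M \<longleftrightarrow> g \<circ> x \<circ> inv_into UNIV g \<in> automorphisms M"
proof
  show "g \<circ> x \<circ> inv_into UNIV g \<in> automorphisms M" if "x \<in> automorphisms M"
    using that assms by (simp add: automorphisms_comp automorphisms_inv)
  assume "g \<circ> x \<circ> inv_into UNIV g \<in> automorphisms M"
  then have "inv_into UNIV g \<circ> (g \<circ> x \<circ> inv_into UNIV g) \<circ> g \<in> automorphisms M"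
    using assms automorphisms_comp automorphisms_inv by blast
  moreover have "inv_into UNIV g \<circ> (g \<circ> x \<circ> inv_into UNIV g) \<circ> g = x"
    by (auto simp: inv_into_UNIV_bij [OF automorphisms_bij [OF assms]])
  ultimately show "x \<in> automorphisms M" by simp
qed

section \<open>Open subgroups in the topology of pointwise convergence\<close>

text \<open>Evaluation at a point is continuous into a discrete space, so prescribing finitely many
  values is an open condition. For an automorphism \<open>g\<close> the set is the left coset of
  \<open>pw_stab M A\<close> through \<open>g\<close>.\<close>

lemma openin_Aut_topology_agree:
  assumes "finite A"
  shows "openin (Aut_topology M) {x \<in> automorphisms M. \<forall>a\<in>A. x a = g a}"
proof -
  have "open ((\<lambda>x :: nat \<Rightarrow> nat. x a) -` {g a})" for a
    by (intro open_vimage open_discrete continuous_on_product_coordinates)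
  then have "open (\<Inter>a\<in>A. (\<lambda>x. x a) -` {g a})"
    using assms by (intro open_INT) auto
  moreover have "{x \<in> automorphisms M. \<forall>a\<in>A. x a = g a}
      = automorphisms M \<inter> (\<Inter>a\<in>A. (\<lambda>x. x a) -` {g a})" by auto
  ultimately show ?thesis
    unfolding Aut_topology_def carrier_Aut_str openin_open by blast
qed

lemma openin_pw_stab: "finite A \<Longrightarrow> openin (Aut_topology M) (pw_stab M A)"
  using openin_Aut_topology_agree [of A M id] by (simp add: pw_stab_def)

text \<open>\<open>U\<close> is a union of left cosets of \<open>pw_stab M A\<close>, and each coset
  consists of the automorphisms with prescribed values on the finite set \<open>A\<close>.\<close>

lemma openin_subgroup_mono:
  assumes "finite A" "pw_stab M A \<subseteq> U" "subgroup U (Aut_str M)"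
  shows "openin (Aut_topology M) U"
proof (subst openin_subopen, intro ballI)
  fix g assume g: "g \<in> U"
  note U = subgroup_Aut_strD [OF assms(3)]
  have ga: "g \<in> automorphisms M" using g U(1) by auto
  note gi = inv_into_UNIV_bij [OF automorphisms_bij [OF ga]]
  let ?V = "{x \<in> automorphisms M. \<forall>a\<in>A. x a = g a}"
  have "?V \<subseteq> U"
  proof
    fix x assume x: "x \<in> ?V"
    then have "inv_into UNIV g \<circ> x \<in> pw_stab M A"
      using ga by (auto simp: pw_stab_iff gi automorphisms_comp automorphisms_inv)
    then have "g \<circ> (inv_into UNIV g \<circ> x) \<in> U" using assms(2) g U(3) by blast
    moreover have "g \<circ> (inv_into UNIV g \<circ> x) = x" by (auto simp: gi)
    ultimately show "x \<in> U" by simp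
  qed
  then show "\<exists>T. openin (Aut_topology M) T \<and> g \<in> T \<and> T \<subseteq> U"
    using openin_Aut_topology_agree [OF assms(1), of M g] ga by (intro exI [of _ ?V]) auto
qed

section \<open>Equivariance of Galois-algebraic closure, and finite invariant sets\<close>

text \<open>Conjugating back by \<open>g\<close> sends the pointwise stabilizer of the image of
  \<open>A\<close> into that of \<open>A\<close>, so the orbit of \<open>g a\<close> lies in the
  image under \<open>g\<close> of the finite orbit of \<open>a\<close>.\<close>

lemma acl_g_equivariant_subset:
  assumes g: "g \<in> automorphisms M" and a: "a \<in> acl_g M A"
  shows "g a \<in> acl_g M (g ` A)"
proof -
  note gi = inv_into_UNIV_bij [OF automorphisms_bij [OF g]]
  have "{k (g a) | k. k \<in> pw_stab M (g ` A)} \<subseteq> g ` {k a | k. k \<in> pw_stab M A}"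
  proof clarify
    fix k assume k: "k \<in> pw_stab M (g ` A)"
    have "inv_into UNIV g \<circ> k \<circ> g \<in> pw_stab M A"
      using k g by (auto simp: pw_stab_iff gi automorphisms_comp automorphisms_inv)
    then show "k (g a) \<in> g ` {k a | k. k \<in> pw_stab M A}"
      by (intro image_eqI [of _ _ "(inv_into UNIV g \<circ> k \<circ> g) a"] CollectI exI conjI refl)
         (auto simp: gi)
  qed
  then show ?thesis
    using a finite_subset finite_imageI unfolding acl_g_def mem_Collect_eq by blast
qed

lemma acl_g_equivariant:
  assumes g: "g \<in> automorphisms M"
  shows "g ` acl_g M A = acl_g M (g ` A)"
proof
  show "g ` acl_g M A \<subseteq> acl_g M (g ` A)"
    using acl_g_equivariant_subset [OF g] by blast
  note gi = inv_into_UNIV_bij [OF automorphisms_bij [OF g]]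
  show "acl_g M (g ` A) \<subseteq> g ` acl_g M A"
  proof
    fix b assume "b \<in> acl_g M (g ` A)"
    then have "inv_into UNIV g b \<in> acl_g M (inv_into UNIV g ` g ` A)"
      by (rule acl_g_equivariant_subset [OF automorphisms_inv [OF g]])
    then have "inv_into UNIV g b \<in> acl_g M A"
      by (simp add: image_image gi)
    then show "b \<in> g ` acl_g M A" by (metis gi(1) image_eqI)
  qed
qed

text \<open>For finite \<open>A\<close> this puts an open subgroup inside
  \<open>set_stab M (acl_g M A)\<close>, which is therefore open, whereas
  \<open>pw_stab M (acl_g M A)\<close> may fail to be.\<close>

lemma pw_stab_subset_set_stab_acl: "pw_stab M A \<subseteq> set_stab M (acl_g M A)"
proof
  fix g assume g: "g \<in> pw_stab M A"
  then have "g ` A = A" by (auto simp: pw_stab_iff)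
  then show "g \<in> set_stab M (acl_g M A)"
    using g acl_g_equivariant [of g M A] by (simp add: set_stab_iff pw_stab_iff)
qed

text \<open>\<open>C\<close> is the union of the orbits of the points of \<open>B\<close> under
  \<open>pw_stab M A\<close>, finitely many finite sets. For finite \<open>A\<close> it yields an
  open subgroup \<open>pw_stab M (A \<union> C)\<close> that is normal in
  \<open>pw_stab M A\<close>.\<close>

lemma finite_invariant_superset:
  assumes "finite B" "B \<subseteq> acl_g M A"
  obtains C where "finite C" "B \<subseteq> C" "\<And>g. g \<in> pw_stab M A \<Longrightarrow> g ` C \<subseteq> C"
proof
  let ?C = "\<Union>b\<in>B. {g b | g. g \<in> pw_stab M A}"
  show "finite ?C" using assms by (auto simp: acl_g_def)
  have "id \<in> pw_stab M A" by (simp add: pw_stab_iff automorphisms_id)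
  then show "B \<subseteq> ?C"
    by (auto intro!: exI [of _ id])
  show "g ` ?C \<subseteq> ?C" if g: "g \<in> pw_stab M A" for g
  proof clarify
    fix b k assume "b \<in> B" "k \<in> pw_stab M A"
    then show "g (k b) \<in> ?C"
      using subgroup_Aut_strD(3) [OF subgroup_pw_stab g, of k]
      by (auto intro!: bexI [of _ b] exI [of _ "g \<circ> k"])
  qed
qed

section \<open>Topological automorphisms\<close>

lemma carrier_Aut_top:
  "\<alpha> \<in> carrier (Aut_top M) \<longleftrightarrow>
     \<alpha> \<in> auto (Aut_str M) \<and> homeomorphic_map (Aut_topology M) (Aut_topology M) \<alpha>"
  by (simp add: Aut_top_def)

lemma topspace_Aut_topology [simp]: "topspace (Aut_topology M) = automorphisms M"
  by (simp add: Aut_topology_def)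

lemma Bij_eqI:
  assumes "f \<in> Bij S" "g \<in> Bij S" "\<And>x. x \<in> S \<Longrightarrow> f x = g x"
  shows "f = g"
  using assms by (meson Bij_imp_extensional extensionalityI)

lemma subgroup_Aut_top:
  "subgroup (carrier (Aut_top M)) (AutoGroup (Aut_str M))"
proof (rule group.subgroupI [OF group.AutoGroup [OF group_Aut_str]])
  let ?A = "automorphisms M" and ?T = "Aut_topology M"
  have id: "\<one>\<^bsub>AutoGroup (Aut_str M)\<^esub> \<in> carrier (Aut_top M)"
  proof -
    have "homeomorphic_map ?T ?T (\<lambda>x\<in>?A. x)"
      by (rule homeomorphic_map_eq [of _ _ id]) simp_all
    then show ?thesis
      using group.id_in_auto [OF group_Aut_str, of M]
      by (simp add: carrier_Aut_top AutoGroup_def BijGroup_def)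
  qed
  then show "carrier (Aut_top M) \<noteq> {}" by blast
  show "carrier (Aut_top M) \<subseteq> carrier (AutoGroup (Aut_str M))"
    by (auto simp: carrier_Aut_top AutoGroup_def)
  fix \<alpha> assume a: "\<alpha> \<in> carrier (Aut_top M)"
  then have au: "\<alpha> \<in> auto (Aut_str M)" and B: "\<alpha> \<in> Bij ?A"
    and h: "homeomorphic_map ?T ?T \<alpha>"
    by (auto simp: carrier_Aut_top auto_def)
  show "inv\<^bsub>AutoGroup (Aut_str M)\<^esub> \<alpha> \<in> carrier (Aut_top M)"
  proof -
    have e: "inv\<^bsub>AutoGroup (Aut_str M)\<^esub> \<alpha> = (\<lambda>x\<in>?A. inv_into ?A \<alpha> x)"
      using group.m_inv_consistent [OF group_BijGroup group.subgroup_auto [OF group_Aut_str] au]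
        inv_BijGroup [OF B]
      by (simp add: AutoGroup_def)
    have "(\<lambda>x\<in>?A. inv_into ?A \<alpha> x) \<in> auto (Aut_str M)"
      using group.restrict_inv_into_hom [OF group_Aut_str, of \<alpha> M] restrict_inv_into_Bij [OF B] au
      by (auto simp: auto_def)
    \<comment> \<open>The group inverse is a restricted \<open>inv_into\<close>; on the carrier it
      agrees with the inverse homeomorphism \<open>\<beta>\<close>, and so is a homeomorphism
      itself.\<close>
    moreover obtain \<beta> where \<beta>: "homeomorphic_maps ?T ?T \<alpha> \<beta>"
      using h homeomorphic_map_maps by blast
    then have \<beta>h: "homeomorphic_map ?T ?T \<beta>"
      by (meson homeomorphic_maps_map)
    have "inv_into ?A \<alpha> x = \<beta> x" if "x \<in> ?A" for x
    proof -
      have "\<beta> x \<in> ?A" "\<alpha> (\<beta> x) = x"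
        using \<beta> \<beta>h that homeomorphic_imp_surjective_map [OF \<beta>h]
        unfolding homeomorphic_maps_def by auto
      then show ?thesis
        using B by (metis Bij_def IntD2 bij_betw_imp_inj_on inv_into_f_f mem_Collect_eq)
    qed
    then have "homeomorphic_map ?T ?T (\<lambda>x\<in>?A. inv_into ?A \<alpha> x)"
      by (intro homeomorphic_map_eq [OF \<beta>h]) simp
    ultimately show ?thesis by (simp add: e carrier_Aut_top)
  qed
  fix \<beta> assume b: "\<beta> \<in> carrier (Aut_top M)"
  then have bu: "\<beta> \<in> auto (Aut_str M)" and B': "\<beta> \<in> Bij ?A"
    and h': "homeomorphic_map ?T ?T \<beta>"
    by (auto simp: carrier_Aut_top auto_def)
  have "homeomorphic_map ?T ?T (compose ?A \<alpha> \<beta>)"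
    by (rule homeomorphic_map_eq [OF homeomorphic_map_compose [OF h' h]]) (simp add: compose_def)
  moreover have "\<alpha> \<otimes>\<^bsub>AutoGroup (Aut_str M)\<^esub> \<beta> = compose ?A \<alpha> \<beta>"
    using B B' by (simp add: AutoGroup_def BijGroup_def)
  moreover have "\<alpha> \<otimes>\<^bsub>AutoGroup (Aut_str M)\<^esub> \<beta> \<in> auto (Aut_str M)"
    using subgroup.m_closed [OF group.subgroup_auto [OF group_Aut_str] au bu]
    by (simp add: AutoGroup_def)
  ultimately show "\<alpha> \<otimes>\<^bsub>AutoGroup (Aut_str M)\<^esub> \<beta> \<in> carrier (Aut_top M)"
    by (simp add: carrier_Aut_top)
qed

lemma Aut_top_alt: "Aut_top M = (AutoGroup (Aut_str M))\<lparr>carrier := carrier (Aut_top M)\<rparr>"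
  by (simp add: Aut_top_def)

lemma group_Aut_top: "group (Aut_top M)"
  by (subst Aut_top_alt)
     (rule subgroup.subgroup_is_group [OF subgroup_Aut_top group.AutoGroup [OF group_Aut_str]])

lemma Aut_topD:
  assumes "\<alpha> \<in> carrier (Aut_top M)"
  shows "\<alpha> \<in> Bij (automorphisms M)"
    and "inj_on \<alpha> (automorphisms M)"
    and "\<alpha> ` automorphisms M = automorphisms M"
    and "\<alpha> \<in> hom (Aut_str M) (Aut_str M)"
    and "homeomorphic_map (Aut_topology M) (Aut_topology M) \<alpha>"
  using assms by (auto simp: carrier_Aut_top auto_def Bij_def bij_betw_def)

lemma Aut_top_mult:
  assumes "\<alpha> \<in> carrier (Aut_top M)" "\<beta> \<in> carrier (Aut_top M)"
  shows "\<alpha> \<otimes>\<^bsub>Aut_top M\<^esub> \<beta> = compose (automorphisms M) \<alpha> \<beta>"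
  using Aut_topD(1) [OF assms(1)] Aut_topD(1) [OF assms(2)]
  by (simp add: Aut_top_def AutoGroup_def BijGroup_def)

lemma Aut_top_one: "\<one>\<^bsub>Aut_top M\<^esub> = (\<lambda>x\<in>automorphisms M. x)"
  by (simp add: Aut_top_def AutoGroup_def BijGroup_def)

text \<open>The product is \<open>compose\<close>, which is \<open>undefined\<close> off the
  carrier; hence the restriction to subsets \<open>U\<close> of the carrier.\<close>

lemma Aut_top_image:
  assumes "\<alpha> \<in> carrier (Aut_top M)" "\<beta> \<in> carrier (Aut_top M)" "U \<subseteq> automorphisms M"
  shows "(\<alpha> \<otimes>\<^bsub>Aut_top M\<^esub> \<beta>) ` U = \<alpha> ` \<beta> ` U"
  unfolding Aut_top_mult [OF assms(1,2)] image_image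
  using assms(3) by (intro image_cong) (auto simp: compose_def)

lemma Aut_top_inv_image:
  assumes "\<alpha> \<in> carrier (Aut_top M)" "U \<subseteq> automorphisms M"
  shows "(inv\<^bsub>Aut_top M\<^esub> \<alpha>) ` \<alpha> ` U = U" "\<alpha> ` (inv\<^bsub>Aut_top M\<^esub> \<alpha>) ` U = U"
proof -
  interpret group "Aut_top M" by (rule group_Aut_top)
  have one: "\<one>\<^bsub>Aut_top M\<^esub> ` U = U"
    using assms(2) by (force simp: Aut_top_one)
  show "(inv\<^bsub>Aut_top M\<^esub> \<alpha>) ` \<alpha> ` U = U" "\<alpha> ` (inv\<^bsub>Aut_top M\<^esub> \<alpha>) ` U = U"
    using Aut_top_image [OF _ _ assms(2), of "inv\<^bsub>Aut_top M\<^esub> \<alpha>" \<alpha>]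
      Aut_top_image [OF _ _ assms(2), of \<alpha> "inv\<^bsub>Aut_top M\<^esub> \<alpha>"] assms(1) one
    by simp_all
qed

lemma Aut_top_comp:
  assumes "\<alpha> \<in> carrier (Aut_top M)" "g \<in> automorphisms M" "h \<in> automorphisms M"
  shows "\<alpha> (g \<circ> h) = \<alpha> g \<circ> \<alpha> h"
proof -
  have "\<alpha> g \<in> automorphisms M" "\<alpha> h \<in> automorphisms M"
    using Aut_topD(3) [OF assms(1)] assms(2,3) by auto
  then show ?thesis
    using hom_mult [OF Aut_topD(4) [OF assms(1)], of g h] assms(2,3) by (simp add: Aut_str_mult)
qed

lemma Aut_top_inv:
  assumes "\<alpha> \<in> carrier (Aut_top M)" "g \<in> automorphisms M"
  shows "\<alpha> (inv_into UNIV g) = inv_into UNIV (\<alpha> g)"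
proof -
  have "\<alpha> g \<in> automorphisms M"
    using Aut_topD(3) [OF assms(1)] assms(2) by auto
  then show ?thesis
    using group_hom.hom_inv [OF group_hom.intro [OF group_Aut_str group_Aut_str],
        where x = g, OF group_hom_axioms.intro [OF Aut_topD(4) [OF assms(1)]]]
      assms(2)
    by (simp add: Aut_str_inv)
qed

lemma Aut_top_subgroup:
  assumes "\<alpha> \<in> carrier (Aut_top M)" "subgroup U (Aut_str M)"
  shows "subgroup (\<alpha> ` U) (Aut_str M)"
  using group_hom.subgroup_img_is_subgroup [OF group_hom.intro [OF group_Aut_str group_Aut_str]]
    Aut_topD(4) [OF assms(1)] assms(2)
  by (simp add: group_hom_axioms_def)

lemma Aut_top_openin:
  assumes "\<alpha> \<in> carrier (Aut_top M)" "openin (Aut_topology M) U"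
  shows "openin (Aut_topology M) (\<alpha> ` U)"
  using homeomorphic_imp_open_map [OF Aut_topD(5) [OF assms(1)]] assms(2)
  by (simp add: open_map_def)

section \<open>Split extensions\<close>

text \<open>Every \<open>g\<close> factors uniquely as a kernel element times a value of
  \<open>s\<close>, the latter being \<open>s (p g)\<close>. Multiplying two such products moves
  \<open>s q\<close> past a kernel element, which costs the conjugation recorded in
  \<open>\<theta>\<close>.\<close>

lemma split_extension:
  fixes G :: "('a, 'm) monoid_scheme" and Q :: "('b, 'n) monoid_scheme"
  assumes "group G" "group Q" and p: "p \<in> hom G Q" and s: "s \<in> hom Q G"
    and ps: "\<forall>q \<in> carrier Q. p (s q) = q"
  defines "N \<equiv> kernel G Q p"
  defines "\<theta> \<equiv> section_action G N s"
  shows "\<theta> \<in> hom Q (AutoGroup (G\<lparr>carrier := N\<rparr>))"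
    and "G \<cong> semidirect_product (G\<lparr>carrier := N\<rparr>) \<theta> Q"
proof -
  interpret G: group G by fact
  interpret Q: group Q by fact
  interpret p: group_hom G Q p by unfold_locales (rule p)
  interpret s: group_hom Q G s by unfold_locales (rule s)
  interpret N: normal N G unfolding N_def by (rule p.normal_kernel)
  have NG: "n \<in> carrier G" if "n \<in> N" for n using that N.subset by blast
  have \<theta>_apply: "\<theta> q n = s q \<otimes>\<^bsub>G\<^esub> n \<otimes>\<^bsub>G\<^esub> inv\<^bsub>G\<^esub> (s q)" if "n \<in> N" for q n
    using that by (simp add: \<theta>_def section_action_def)
  have \<theta>_closed: "\<theta> q n \<in> N" if "q \<in> carrier Q" "n \<in> N" for q n
    using that by (simp add: \<theta>_apply N.inv_op_closed2)
  have \<theta>_mult: "\<theta> (q \<otimes>\<^bsub>Q\<^esub> r) n = \<theta> q (\<theta> r n)"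
    if "q \<in> carrier Q" "r \<in> carrier Q" "n \<in> N" for q r n
    using that \<theta>_closed [of r n] NG by (simp add: \<theta>_apply G.m_assoc G.inv_mult_group)
  have \<theta>_one: "\<theta> \<one>\<^bsub>Q\<^esub> n = n" if "n \<in> N" for n
    using that NG by (simp add: \<theta>_apply)
  have \<theta>_hom: "\<theta> q (m \<otimes>\<^bsub>G\<^esub> n) = \<theta> q m \<otimes>\<^bsub>G\<^esub> \<theta> q n"
    if "q \<in> carrier Q" "m \<in> N" "n \<in> N" for q m n
  proof -
    have "inv\<^bsub>G\<^esub> (s q) \<otimes>\<^bsub>G\<^esub> (s q \<otimes>\<^bsub>G\<^esub> (n \<otimes>\<^bsub>G\<^esub> inv\<^bsub>G\<^esub> (s q))) = n \<otimes>\<^bsub>G\<^esub> inv\<^bsub>G\<^esub> (s q)"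
      using that NG by (simp flip: G.m_assoc)
    then show ?thesis
      using that NG by (simp add: \<theta>_apply G.m_assoc)
  qed
  have \<theta>_Bij: "\<theta> q \<in> Bij N" if q: "q \<in> carrier Q" for q
  proof -
    have "bij_betw (\<theta> q) N N"
    proof (rule bij_betw_byWitness [where f' = "\<theta> (inv\<^bsub>Q\<^esub> q)"])
      show "\<forall>n\<in>N. \<theta> (inv\<^bsub>Q\<^esub> q) (\<theta> q n) = n" "\<forall>n\<in>N. \<theta> q (\<theta> (inv\<^bsub>Q\<^esub> q) n) = n"
        using q by (simp_all add: \<theta>_one flip: \<theta>_mult)
    qed (use q \<theta>_closed in auto)
    then show ?thesis
      by (simp add: Bij_def \<theta>_def section_action_def)
  qed
  show "\<theta> \<in> hom Q (AutoGroup (G\<lparr>carrier := N\<rparr>))"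
  proof (rule homI)
    fix q assume q: "q \<in> carrier Q"
    show "\<theta> q \<in> carrier (AutoGroup (G\<lparr>carrier := N\<rparr>))"
      using q \<theta>_Bij \<theta>_hom \<theta>_closed by (auto simp: AutoGroup_def auto_def hom_def)
    fix r assume r: "r \<in> carrier Q"
    have "\<theta> (q \<otimes>\<^bsub>Q\<^esub> r) = compose N (\<theta> q) (\<theta> r)"
      using q r by (intro Bij_eqI [of _ N] compose_Bij \<theta>_Bij) (simp_all add: compose_def \<theta>_mult)
    then show "\<theta> (q \<otimes>\<^bsub>Q\<^esub> r) = \<theta> q \<otimes>\<^bsub>AutoGroup (G\<lparr>carrier := N\<rparr>)\<^esub> \<theta> r"
      using q r \<theta>_Bij by (simp add: AutoGroup_def BijGroup_def)
  qed
  \<comment> \<open>The first component is the kernel factor of \<open>g\<close>; the inverse of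
    \<open>f\<close> multiplies the two components back together.\<close>
  define f where "f g = (g \<otimes>\<^bsub>G\<^esub> inv\<^bsub>G\<^esub> (s (p g)), p g)" for g
  have fN: "g \<otimes>\<^bsub>G\<^esub> inv\<^bsub>G\<^esub> (s (p g)) \<in> N" if "g \<in> carrier G" for g
    unfolding N_def kernel_def using that by (simp add: ps)
  have pN: "p n = \<one>\<^bsub>Q\<^esub>" if "n \<in> N" for n
    using that unfolding N_def kernel_def by simp
  have "f \<in> iso G (semidirect_product (G\<lparr>carrier := N\<rparr>) \<theta> Q)"
  proof (rule isoI)
    show "f \<in> hom G (semidirect_product (G\<lparr>carrier := N\<rparr>) \<theta> Q)"
    proof (rule homI)
      fix g assume g: "g \<in> carrier G"
      then show "f g \<in> carrier (semidirect_product (G\<lparr>carrier := N\<rparr>) \<theta> Q)"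
        using fN by (simp add: f_def semidirect_product_def)
      fix h assume h: "h \<in> carrier G"
      \<comment> \<open>In the product of \<open>f g\<close> and \<open>f h\<close> the inverse of
        \<open>s (p g)\<close> meets the \<open>s (p g)\<close> contributed by the action. This is
        their cancellation in right-associated form, ready for rewriting with
        \<open>G.m_assoc\<close>.\<close>
      have "inv\<^bsub>G\<^esub> (s (p g)) \<otimes>\<^bsub>G\<^esub> (s (p g) \<otimes>\<^bsub>G\<^esub> (h \<otimes>\<^bsub>G\<^esub> (inv\<^bsub>G\<^esub> (s (p h)) \<otimes>\<^bsub>G\<^esub> inv\<^bsub>G\<^esub> (s (p g)))))
          = h \<otimes>\<^bsub>G\<^esub> (inv\<^bsub>G\<^esub> (s (p h)) \<otimes>\<^bsub>G\<^esub> inv\<^bsub>G\<^esub> (s (p g)))"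
        using g h by (simp flip: G.m_assoc)
      then show "f (g \<otimes>\<^bsub>G\<^esub> h) = f g \<otimes>\<^bsub>semidirect_product (G\<lparr>carrier := N\<rparr>) \<theta> Q\<^esub> f h"
        using g h fN by (simp add: f_def semidirect_product_def \<theta>_apply G.m_assoc G.inv_mult_group)
    qed
    show "bij_betw f (carrier G) (carrier (semidirect_product (G\<lparr>carrier := N\<rparr>) \<theta> Q))"
    proof (rule bij_betw_byWitness [where f' = "\<lambda>(n, q). n \<otimes>\<^bsub>G\<^esub> s q"])
      show "\<forall>g\<in>carrier G. (case f g of (n, q) \<Rightarrow> n \<otimes>\<^bsub>G\<^esub> s q) = g"
        by (simp add: f_def G.m_assoc)
      show "\<forall>x\<in>carrier (semidirect_product (G\<lparr>carrier := N\<rparr>) \<theta> Q).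
          f (case x of (n, q) \<Rightarrow> n \<otimes>\<^bsub>G\<^esub> s q) = x"
        by (auto simp: f_def semidirect_product_def NG pN ps G.m_assoc)
    qed (use NG fN in \<open>auto simp: f_def semidirect_product_def\<close>)
  qed
  then show "G \<cong> semidirect_product (G\<lparr>carrier := N\<rparr>) \<theta> Q"
    by (rule is_isoI)
qed

section \<open>Supports of open subgroups\<close>

lemma automorphisms_acl_sets:
  assumes "g \<in> automorphisms M" "K \<in> acl_sets M"
  shows "g ` K \<in> acl_sets M"
  using assms acl_g_equivariant [OF assms(1)] unfolding acl_sets_def by blast

lemma geom_cl_subset: "geom_cl M X \<subseteq> geom M"
  by (auto simp: geom_cl_def)

locale lascar_pregeometry =
  fixes M :: "('f, 'r) omega_structure"
  assumes lascar: "Lascar_property M" and pregeom: "pregeometry UNIV (acl_g M)"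
begin

lemma acl_extensive: "A \<subseteq> acl_g M A"
  using pregeom unfolding pregeometry_def by simp

lemma acl_mono: "A \<subseteq> B \<Longrightarrow> acl_g M A \<subseteq> acl_g M B"
  using pregeom unfolding pregeometry_def by simp

lemma acl_idem: "acl_g M (acl_g M A) = acl_g M A"
  using pregeom unfolding pregeometry_def by simp

lemma acl_finite_character: "a \<in> acl_g M A \<Longrightarrow> \<exists>B. finite B \<and> B \<subseteq> A \<and> a \<in> acl_g M B"
  using pregeom unfolding pregeometry_def by simp

lemma acl_exchange: "\<lbrakk>a \<in> acl_g M (insert b A); a \<notin> acl_g M A\<rbrakk> \<Longrightarrow> b \<in> acl_g M (insert a A)"
  using pregeom unfolding pregeometry_def by simp

lemma acl_least: "B \<subseteq> acl_g M A \<Longrightarrow> acl_g M B \<subseteq> acl_g M A"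
  using acl_mono acl_idem by metis

lemma acl_sets_closed: "\<lbrakk>S \<in> acl_sets M; B \<subseteq> S\<rbrakk> \<Longrightarrow> acl_g M B \<subseteq> S"
  unfolding acl_sets_def using acl_least by blast

lemma support_exists:
  assumes "subgroup U (Aut_str M)" "openin (Aut_topology M) U"
  obtains K where "K \<in> acl_sets M" "pw_stab M K \<subseteq> U" "U \<subseteq> set_stab M K"
  using conjunct2 [OF lascar [unfolded Lascar_property_def]] assms by meson

text \<open>Contrapositive of the first clause of the Lascar Property. If \<open>S\<close> were not
  contained in \<open>K\<close>, some conjugate of an \<open>h\<close> in \<open>pw_stab M S\<close>
  by a \<open>g\<close> in \<open>pw_stab M K\<close> would move \<open>S\<close>; but
  \<open>g\<close> lies in \<open>U\<close> and \<open>h\<close> in \<open>V\<close>, so the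
  conjugate lies in \<open>V\<close>, which stabilizes \<open>S\<close>.\<close>

lemma support_antimono_normal:
  assumes "K \<in> acl_sets M" "S \<in> acl_sets M"
    and U: "pw_stab M K \<subseteq> U" and V: "pw_stab M S \<subseteq> V" "V \<subseteq> set_stab M S"
    and conj: "\<And>u v. \<lbrakk>u \<in> U; v \<in> V\<rbrakk> \<Longrightarrow> inv_into UNIV u \<circ> v \<circ> u \<in> V"
  shows "S \<subseteq> K"
proof (rule ccontr)
  assume "\<not> S \<subseteq> K"
  then obtain g h where g: "g \<in> pw_stab M K" and h: "h \<in> pw_stab M S"
    and ne: "(inv\<^bsub>Aut_str M\<^esub> g \<otimes>\<^bsub>Aut_str M\<^esub> h \<otimes>\<^bsub>Aut_str M\<^esub> g) ` S \<noteq> S"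
    using conjunct1 [OF lascar [unfolded Lascar_property_def]] assms(1,2) by meson
  have ga: "g \<in> automorphisms M" "h \<in> automorphisms M"
    using g h by (auto simp: pw_stab_iff)
  then have "inv\<^bsub>Aut_str M\<^esub> g \<otimes>\<^bsub>Aut_str M\<^esub> h \<otimes>\<^bsub>Aut_str M\<^esub> g = inv_into UNIV g \<circ> h \<circ> g"
    by (simp add: Aut_str_mult Aut_str_inv automorphisms_inv automorphisms_comp)
  moreover have "inv_into UNIV g \<circ> h \<circ> g \<in> set_stab M S"
    using conj g h U V by blast
  ultimately show False using ne by (simp add: set_stab_iff)
qed

text \<open>The case in which both \<open>U\<close> and \<open>V\<close> are
  \<open>set_stab M S\<close>, a subgroup and so closed under conjugation by its own elements.
  Applied in both directions, it makes supports unique.\<close>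

lemma subset_if_pw_stab_subset_set_stab:
  assumes "K \<in> acl_sets M" "S \<in> acl_sets M" "pw_stab M K \<subseteq> set_stab M S"
  shows "S \<subseteq> K"
proof (rule support_antimono_normal [OF assms pw_stab_subset_set_stab order_refl])
  fix u v assume "u \<in> set_stab M S" "v \<in> set_stab M S"
  then show "inv_into UNIV u \<circ> v \<circ> u \<in> set_stab M S"
    using subgroup_Aut_strD(2,3) [OF subgroup_set_stab] by blast
qed

text \<open>Inclusion of closed sets thus becomes inclusion of subgroups, a relation that group
  automorphisms preserve.\<close>

lemma pw_stab_subset_iff:
  assumes "K \<in> acl_sets M" "S \<in> acl_sets M"
  shows "pw_stab M K \<subseteq> pw_stab M S \<longleftrightarrow> S \<subseteq> K"
  using subset_if_pw_stab_subset_set_stab [OF assms] pw_stab_antimono pw_stab_subset_set_stab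
  by blast

lemma pw_stab_inject:
  assumes "K \<in> acl_sets M" "S \<in> acl_sets M" "pw_stab M K = pw_stab M S"
  shows "K = S"
  using pw_stab_subset_iff assms by blast

text \<open>Any two conjugates of \<^term>\<open>pw_stab M A\<close> under \<^term>\<open>set_stab M (acl_g M A)\<close> are
  commensurable. Commensurable open subgroups have the same support, so the
  support of \<^term>\<open>\<alpha> ` pw_stab M A\<close> is fixed by \<^term>\<open>\<alpha> ` set_stab M (acl_g M A)\<close>.\<close>

lemma support_image_eq:
  assumes \<alpha>: "\<alpha> \<in> carrier (Aut_top M)" and A: "finite A"
    and K0: "K0 \<in> acl_sets M" "pw_stab M K0 \<subseteq> \<alpha> ` pw_stab M A" "\<alpha> ` pw_stab M A \<subseteq> set_stab M K0"
    and K1: "K1 \<in> acl_sets M" "pw_stab M K1 \<subseteq> \<alpha> ` set_stab M (acl_g M A)"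
      "\<alpha> ` set_stab M (acl_g M A) \<subseteq> set_stab M K1"
  shows "K0 = K1"
proof
  \<comment> \<open>The image of \<open>pw_stab M A\<close> lies in that of
    \<open>set_stab M (acl_g M A)\<close>, so \<open>pw_stab M K0\<close> is contained in
    \<open>set_stab M K1\<close>.\<close>
  show "K1 \<subseteq> K0"
    using subset_if_pw_stab_subset_set_stab [OF K0(1) K1(1)] K0(2) K1(3)
      pw_stab_subset_set_stab_acl [of M A] by blast
  \<comment> \<open>The images under \<open>\<alpha>\<close> of \<open>pw_stab M A\<close> and of
    its conjugate by \<open>g\<close> have as supports \<open>K0\<close> and its translate by
    \<open>\<alpha> g\<close>. Both contain the image of a common open subgroup \<open>V\<close>,
    with support \<open>KV\<close>. Normality of \<open>V\<close> in \<open>pw_stab M A\<close>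
    gives \<open>KV \<subseteq> K0\<close>; containment in the conjugate puts the translate inside
    \<open>KV\<close>.\<close>
  have sub: "(\<alpha> g) ` K0 \<subseteq> K0" if g: "g \<in> set_stab M (acl_g M A)" for g
  proof -
    have ga: "g \<in> automorphisms M" and "g ` A \<subseteq> acl_g M A"
      using g acl_extensive [of A] by (auto simp: set_stab_iff)
    then obtain C where C: "finite C" "g ` A \<subseteq> C" "\<And>u. u \<in> pw_stab M A \<Longrightarrow> u ` C \<subseteq> C"
      using finite_invariant_superset [of "g ` A" M A] A by blast
    \<comment> \<open>\<open>V\<close> is open because \<open>A \<union> C\<close> is finite, normal
      in \<open>pw_stab M A\<close> because \<open>C\<close> is invariant, and contained in the
      conjugate by \<open>g\<close> because \<open>C\<close> contains the image of \<open>A\<close>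
      under \<open>g\<close>.\<close>
    define V where "V = pw_stab M (A \<union> C)"
    have "subgroup (\<alpha> ` V) (Aut_str M)" and "openin (Aut_topology M) (\<alpha> ` V)"
      unfolding V_def using A C(1) \<alpha>
      by (auto intro: Aut_top_subgroup Aut_top_openin subgroup_pw_stab openin_pw_stab)
    then obtain KV where KV: "KV \<in> acl_sets M" "pw_stab M KV \<subseteq> \<alpha> ` V" "\<alpha> ` V \<subseteq> set_stab M KV"
      by (rule support_exists)
    have "KV \<subseteq> K0"
    proof (rule support_antimono_normal [OF K0(1) KV(1) K0(2) KV(2,3)])
      fix x y assume "x \<in> \<alpha> ` pw_stab M A" "y \<in> \<alpha> ` V"
      then obtain u v where u: "u \<in> pw_stab M A" "x = \<alpha> u" and v: "v \<in> V" "y = \<alpha> v" by blast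
      have a: "u \<in> automorphisms M" "v \<in> automorphisms M"
        using u v by (auto simp: V_def pw_stab_iff)
      note ui = inv_into_UNIV_bij [OF automorphisms_bij [OF a(1)]]
      have "inv_into UNIV u \<circ> v \<circ> u \<in> V"
        unfolding V_def pw_stab_iff
      proof (intro conjI ballI)
        show "inv_into UNIV u \<circ> v \<circ> u \<in> automorphisms M"
          using a by (simp add: automorphisms_comp automorphisms_inv)
        fix c assume c: "c \<in> A \<union> C"
        then have "u c \<in> A \<union> C"
          using u(1) C(3) [OF u(1)] by (auto simp: pw_stab_iff)
        then have "v (u c) = u c"
          using v(1) by (auto simp: V_def pw_stab_iff)
        then show "(inv_into UNIV u \<circ> v \<circ> u) c = c" by (simp add: ui)
      qed
      moreover have "\<alpha> (inv_into UNIV u \<circ> v \<circ> u) = inv_into UNIV x \<circ> y \<circ> x"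
        unfolding u(2) v(2) using a \<alpha>
        by (simp add: Aut_top_comp Aut_top_inv automorphisms_comp automorphisms_inv fun_eq_iff)
      ultimately show "inv_into UNIV x \<circ> y \<circ> x \<in> \<alpha> ` V" by (metis image_eqI)
    qed
    moreover have "\<alpha> g ` K0 \<subseteq> KV"
    proof (rule subset_if_pw_stab_subset_set_stab [OF KV(1)])
      have \<alpha>g: "\<alpha> g \<in> automorphisms M" using ga Aut_topD(3) [OF \<alpha>] by blast
      then show "\<alpha> g ` K0 \<in> acl_sets M" using K0(1) by (rule automorphisms_acl_sets)
      have "\<alpha> ` V \<subseteq> set_stab M (\<alpha> g ` K0)"
      proof clarify
        fix v assume "v \<in> V"
        then have "v \<in> pw_stab M (g ` A)"
          using C(2) pw_stab_antimono [of "g ` A" "A \<union> C" M] unfolding V_def by blast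
        then obtain w where w: "w \<in> pw_stab M A" "v = g \<circ> w \<circ> inv_into UNIV g"
          using pw_stab_conj [OF automorphisms_bij [OF ga] automorphisms_conj_iff [OF ga], of A]
          by blast
        have wa: "w \<in> automorphisms M" using w by (simp add: pw_stab_iff)
        then have e: "\<alpha> v = \<alpha> g \<circ> \<alpha> w \<circ> inv_into UNIV (\<alpha> g)"
          unfolding w(2) using ga \<alpha>
          by (simp add: Aut_top_comp Aut_top_inv automorphisms_comp automorphisms_inv fun_eq_iff)
        have W: "\<alpha> w \<in> automorphisms M" "\<alpha> w ` K0 = K0"
          using subsetD [OF K0(3) imageI [OF w(1)]] by (simp_all add: set_stab_iff)
        have "inv_into UNIV (\<alpha> g) ` \<alpha> g ` K0 = K0"
          using inv_into_UNIV_bij(2) [OF automorphisms_bij [OF \<alpha>g]] by (simp add: image_image)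
        then have "\<alpha> v ` \<alpha> g ` K0 = \<alpha> g ` K0"
          using W(2) unfolding e image_comp [symmetric] by simp
        then show "\<alpha> v \<in> set_stab M (\<alpha> g ` K0)"
          using W(1) \<alpha>g e by (simp add: set_stab_iff automorphisms_comp automorphisms_inv)
      qed
      then show "pw_stab M KV \<subseteq> set_stab M (\<alpha> g ` K0)" using KV(2) by blast
    qed
    ultimately show ?thesis by blast
  qed
  \<comment> \<open>Applying \<open>sub\<close> to the inverse of \<open>g\<close> turns the
    inclusion into an equality.\<close>
  have "\<alpha> ` set_stab M (acl_g M A) \<subseteq> set_stab M K0"
  proof clarify
    fix g assume g: "g \<in> set_stab M (acl_g M A)"
    then have ga: "g \<in> automorphisms M" by (simp add: set_stab_iff)
    then have \<alpha>g: "\<alpha> g \<in> automorphisms M" using Aut_topD(3) [OF \<alpha>] by blast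
    have "inv_into UNIV (\<alpha> g) ` K0 \<subseteq> K0"
      using sub [OF subgroup_Aut_strD(2) [OF subgroup_set_stab g]] by (simp add: Aut_top_inv [OF \<alpha> ga])
    then have "K0 \<subseteq> \<alpha> g ` K0"
      using inv_into_UNIV_bij(1) [OF automorphisms_bij [OF \<alpha>g]]
      by (metis image_eqI image_subset_iff subsetI)
    then show "\<alpha> g \<in> set_stab M K0"
      using sub [OF g] \<alpha>g by (auto simp: set_stab_iff)
  qed
  then show "K0 \<subseteq> K1"
    using subset_if_pw_stab_subset_set_stab [OF K1(1) K0(1)] K1(2) by blast
qed

text \<open>\<open>K'\<close> is the support of the image of \<open>set_stab M K\<close>. The second
  clause of the Lascar Property cannot be applied to \<open>pw_stab M K\<close>, which may not be
  open; this group is instead the intersection of the open groups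
  \<open>pw_stab M (insert b A)\<close> with \<open>b\<close> in \<open>K\<close>, whose images all
  have the support \<open>K'\<close> by \<open>support_image_eq\<close>.\<close>

lemma image_stabilizers_bounds:
  assumes \<alpha>: "\<alpha> \<in> carrier (Aut_top M)" and K: "K \<in> acl_sets M"
  obtains K' where "K' \<in> acl_sets M" "pw_stab M K' \<subseteq> \<alpha> ` pw_stab M K"
    "\<alpha> ` set_stab M K \<subseteq> set_stab M K'"
proof -
  obtain A where A: "finite A" "K = acl_g M A" using K unfolding acl_sets_def by blast
  have "openin (Aut_topology M) (set_stab M K)"
    using openin_subgroup_mono [OF A(1) pw_stab_subset_set_stab_acl subgroup_set_stab] A(2) by simp
  then obtain K1 where K1: "K1 \<in> acl_sets M" "pw_stab M K1 \<subseteq> \<alpha> ` set_stab M K"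
      "\<alpha> ` set_stab M K \<subseteq> set_stab M K1"
    using support_exists [OF Aut_top_subgroup [OF \<alpha> subgroup_set_stab] Aut_top_openin [OF \<alpha>]]
    by blast
  have "pw_stab M K1 \<subseteq> \<alpha> ` pw_stab M K"
  proof
    fix y assume y: "y \<in> pw_stab M K1"
    then obtain x where x: "x \<in> automorphisms M" "y = \<alpha> x"
      using Aut_topD(3) [OF \<alpha>] by (auto simp: pw_stab_iff)
    have "x b = b" if b: "b \<in> K" for b
    proof -
      \<comment> \<open>Adding a point \<open>b\<close> of \<open>K\<close> keeps the closure equal
        to \<open>K\<close>, while the pointwise stabilizer now fixes \<open>b\<close>.\<close>
      let ?C = "insert b A"
      have C: "finite ?C" "acl_g M ?C = K"
        using A b acl_extensive [of A] acl_least [of ?C A] acl_mono [of A ?C] by auto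
      obtain K0 where K0: "K0 \<in> acl_sets M" "pw_stab M K0 \<subseteq> \<alpha> ` pw_stab M ?C"
          "\<alpha> ` pw_stab M ?C \<subseteq> set_stab M K0"
        using support_exists [OF Aut_top_subgroup [OF \<alpha> subgroup_pw_stab]
            Aut_top_openin [OF \<alpha> openin_pw_stab [OF C(1)]]] by blast
      have "K0 = K1"
        using support_image_eq [OF \<alpha> C(1) K0] K1 unfolding C(2) by blast
      then have "\<alpha> x \<in> \<alpha> ` pw_stab M ?C" using y x(2) K0(2) by blast
      then obtain z where "z \<in> pw_stab M ?C" "\<alpha> x = \<alpha> z" by blast
      then have "x \<in> pw_stab M ?C"
        using x(1) Aut_topD(2) [OF \<alpha>] by (metis inj_onD pw_stab_iff)
      then show ?thesis by (simp add: pw_stab_iff)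
    qed
    then show "y \<in> \<alpha> ` pw_stab M K" using x by (simp add: pw_stab_iff)
  qed
  then show thesis using that K1 by blast
qed

text \<open>\<open>image_stabilizers_bounds\<close> yields one inclusion; the reverse one comes from
  using it again for the inverse of \<open>\<alpha>\<close>.\<close>

lemma image_pw_stab:
  assumes \<alpha>: "\<alpha> \<in> carrier (Aut_top M)" and K: "K \<in> acl_sets M"
  shows "\<exists>K' \<in> acl_sets M. \<alpha> ` pw_stab M K = pw_stab M K'"
proof -
  let ?\<beta> = "inv\<^bsub>Aut_top M\<^esub> \<alpha>"
  have \<beta>: "?\<beta> \<in> carrier (Aut_top M)"
    using \<alpha> group.inv_closed [OF group_Aut_top] by blast
  obtain K' where K': "K' \<in> acl_sets M" "pw_stab M K' \<subseteq> \<alpha> ` pw_stab M K"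
      "\<alpha> ` set_stab M K \<subseteq> set_stab M K'"
    by (rule image_stabilizers_bounds [OF \<alpha> K])
  obtain K'' where K'': "K'' \<in> acl_sets M" "pw_stab M K'' \<subseteq> ?\<beta> ` pw_stab M K'"
      "?\<beta> ` set_stab M K' \<subseteq> set_stab M K''"
    by (rule image_stabilizers_bounds [OF \<beta> K'(1)])
  have sub: "pw_stab M S \<subseteq> automorphisms M" "set_stab M S \<subseteq> automorphisms M" for S
    by (auto simp: pw_stab_iff set_stab_iff)
  \<comment> \<open>Pulling the bound on the image of \<open>set_stab M K\<close> back along
    \<open>?\<beta>\<close> gives \<open>K'' \<subseteq> K\<close>, and so bounds
    \<open>pw_stab M K\<close> by \<open>pw_stab M K''\<close>.\<close>
  have "set_stab M K \<subseteq> set_stab M K''"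
    using image_mono [OF K'(3), of ?\<beta>] K''(3) Aut_top_inv_image(1) [OF \<alpha> sub(2)] by blast
  then have "K'' \<subseteq> K"
    using subset_if_pw_stab_subset_set_stab [OF K K''(1)] pw_stab_subset_set_stab by blast
  then have "pw_stab M K \<subseteq> ?\<beta> ` pw_stab M K'"
    using pw_stab_antimono K''(2) by blast
  then have "\<alpha> ` pw_stab M K \<subseteq> pw_stab M K'"
    using image_mono [of _ _ \<alpha>] Aut_top_inv_image(2) [OF \<alpha> sub(1)] by metis
  then show ?thesis using K'(1,2) by blast
qed

section \<open>Order automorphisms of the lattice of closed sets\<close>

definition acl_order_auto :: "(nat set \<Rightarrow> nat set) \<Rightarrow> bool" where
  "acl_order_auto f \<longleftrightarrow> f ` acl_sets M = acl_sets M \<and>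
     (\<forall>K \<in> acl_sets M. \<forall>S \<in> acl_sets M. f K \<subseteq> f S \<longleftrightarrow> K \<subseteq> S)"

lemma acl_bot: "acl_g M {} \<in> acl_sets M" "K \<in> acl_sets M \<Longrightarrow> acl_g M {} \<subseteq> K"
  using acl_sets_closed unfolding acl_sets_def by blast+

text \<open>Exchange makes the closure of a point \<open>a\<close> minimal: any \<open>b\<close> in
  \<open>acl_g M {a}\<close> outside \<open>acl_g M {}\<close> has \<open>a\<close> in its own
  closure. Conversely, an atom is the closure of any of its points outside
  \<open>acl_g M {}\<close>.\<close>

lemma geom_iff_atom:
  "K \<in> geom M \<longleftrightarrow> K \<in> acl_sets M \<and> K \<noteq> acl_g M {} \<and>
     (\<forall>S \<in> acl_sets M. S \<subseteq> K \<longrightarrow> S = K \<or> S = acl_g M {})"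
proof
  assume "K \<in> geom M"
  then obtain a where a: "K = acl_g M {a}" "a \<notin> acl_g M {}" unfolding geom_def by blast
  have "K \<in> acl_sets M" unfolding acl_sets_def a(1) by blast
  moreover have "K \<noteq> acl_g M {}" using a acl_extensive [of "{a}"] by blast
  moreover have "S = K" if S: "S \<in> acl_sets M" "S \<subseteq> K" "S \<noteq> acl_g M {}" for S
  proof -
    obtain b where b: "b \<in> S" "b \<notin> acl_g M {}" using S acl_bot(2) by blast
    then have "a \<in> acl_g M {b}" using acl_exchange [of b a "{}"] S(2) a by blast
    then have "a \<in> S" using acl_sets_closed [OF S(1), of "{b}"] b(1) by blast
    then show ?thesis using acl_sets_closed [OF S(1), of "{a}"] S(2) a(1) by blast
  qed
  ultimately show "K \<in> acl_sets M \<and> K \<noteq> acl_g M {} \<and>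
     (\<forall>S \<in> acl_sets M. S \<subseteq> K \<longrightarrow> S = K \<or> S = acl_g M {})" by blast
next
  assume "K \<in> acl_sets M \<and> K \<noteq> acl_g M {} \<and>
     (\<forall>S \<in> acl_sets M. S \<subseteq> K \<longrightarrow> S = K \<or> S = acl_g M {})"
  then have K: "K \<in> acl_sets M" "K \<noteq> acl_g M {}"
    and atom: "\<And>S. \<lbrakk>S \<in> acl_sets M; S \<subseteq> K\<rbrakk> \<Longrightarrow> S = K \<or> S = acl_g M {}" by simp_all
  obtain a where a: "a \<in> K" "a \<notin> acl_g M {}" using K acl_bot(2) by blast
  have "acl_g M {a} \<in> acl_sets M" unfolding acl_sets_def by blast
  moreover have "acl_g M {a} \<subseteq> K" using acl_sets_closed [OF K(1)] a(1) by simp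
  moreover have "acl_g M {a} \<noteq> acl_g M {}" using a(2) acl_extensive [of "{a}"] by blast
  ultimately have "K = acl_g M {a}" using atom by blast
  then show "K \<in> geom M" using a(2) unfolding geom_def by blast
qed

lemma geom_subset_acl_sets: "geom M \<subseteq> acl_sets M"
  using geom_iff_atom by blast

text \<open>This expresses the closure operator through the order alone. The finite \<open>Y\<close>
  is essential: \<open>acl_sets M\<close> contains only closures of finite sets, so an infinite
  \<open>X\<close> may have no upper bound there. Finite character makes finite subsets
  suffice.\<close>

lemma geom_cl_iff:
  assumes "X \<subseteq> geom M" "K \<in> geom M"
  shows "K \<in> geom_cl M X \<longleftrightarrow>
    (\<exists>Y. finite Y \<and> Y \<subseteq> X \<and> (\<forall>S \<in> acl_sets M. (\<forall>L\<in>Y. L \<subseteq> S) \<longrightarrow> K \<subseteq> S))"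
proof
  assume "K \<in> geom_cl M X"
  moreover obtain a where a: "K = acl_g M {a}" using assms(2) unfolding geom_def by blast
  ultimately have "a \<in> acl_g M (\<Union>X)" using acl_extensive [of "{a}"] unfolding geom_cl_def by blast
  then obtain B where B: "finite B" "B \<subseteq> \<Union>X" "a \<in> acl_g M B" using acl_finite_character by blast
  obtain Y where Y: "finite Y" "Y \<subseteq> X" "B \<subseteq> \<Union>Y" by (rule finite_subset_Union [OF B(1,2)])
  have "K \<subseteq> S" if S: "S \<in> acl_sets M" "\<forall>L\<in>Y. L \<subseteq> S" for S
  proof -
    have "B \<subseteq> S" using S(2) Y(3) by blast
    then have "a \<in> S" using acl_sets_closed [OF S(1)] B(3) by blast
    then show ?thesis using acl_sets_closed [OF S(1)] a by blast
  qed
  then show "\<exists>Y. finite Y \<and> Y \<subseteq> X \<and> (\<forall>S \<in> acl_sets M. (\<forall>L\<in>Y. L \<subseteq> S) \<longrightarrow> K \<subseteq> S)"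
    using Y by blast
next
  assume "\<exists>Y. finite Y \<and> Y \<subseteq> X \<and> (\<forall>S \<in> acl_sets M. (\<forall>L\<in>Y. L \<subseteq> S) \<longrightarrow> K \<subseteq> S)"
  then obtain Y where Y: "finite Y" "Y \<subseteq> X"
    and least: "\<forall>S \<in> acl_sets M. (\<forall>L\<in>Y. L \<subseteq> S) \<longrightarrow> K \<subseteq> S"
    by (elim exE conjE)
  \<comment> \<open>\<open>A\<close> picks one generator for each member of \<open>Y\<close>, so
    that \<open>acl_g M A\<close> is an upper bound of \<open>Y\<close> inside
    \<open>acl_sets M\<close>.\<close>
  have "Y \<subseteq> (\<lambda>a. acl_g M {a}) ` UNIV" using Y(2) assms(1) unfolding geom_def by blast
  then obtain A where A: "finite A" "Y = (\<lambda>a. acl_g M {a}) ` A"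
    using finite_subset_image [OF Y(1)] by meson
  have "acl_g M {a} \<subseteq> acl_g M A" if "a \<in> A" for a
    using that by (intro acl_mono) simp
  then have "\<forall>L\<in>Y. L \<subseteq> acl_g M A"
    unfolding A(2) by blast
  moreover have "acl_g M A \<in> acl_sets M" using A(1) unfolding acl_sets_def by blast
  ultimately have "K \<subseteq> acl_g M A" using least by simp
  moreover have "A \<subseteq> \<Union>X"
  proof
    fix a assume "a \<in> A"
    then have "acl_g M {a} \<in> X" using A(2) Y(2) by blast
    then show "a \<in> \<Union>X" using acl_extensive [of "{a}"] by blast
  qed
  then have "acl_g M A \<subseteq> acl_g M (\<Union>X)" by (rule acl_mono)
  ultimately show "K \<in> geom_cl M X"
    using assms(2) unfolding geom_cl_def by blast
qed

text \<open>By \<open>geom_iff_atom\<close> the points are the atoms of the order, and an order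
  automorphism fixes the least element.\<close>

lemma acl_order_auto_geom:
  assumes f: "acl_order_auto f" and K: "K \<in> acl_sets M"
  shows "f K \<in> geom M \<longleftrightarrow> K \<in> geom M"
proof -
  have fP: "f ` acl_sets M = acl_sets M"
    and mono: "\<And>K S. \<lbrakk>K \<in> acl_sets M; S \<in> acl_sets M\<rbrakk> \<Longrightarrow> f K \<subseteq> f S \<longleftrightarrow> K \<subseteq> S"
    using f unfolding acl_order_auto_def by auto
  have inj: "f K = f S \<longleftrightarrow> K = S" if "K \<in> acl_sets M" "S \<in> acl_sets M" for K S
    using that mono by (metis subset_antisym order_refl)
  have bot: "f (acl_g M {}) = acl_g M {}"
  proof -
    obtain B where B: "B \<in> acl_sets M" "f B = acl_g M {}" using fP acl_bot(1) by (metis imageE)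
    then have "f (acl_g M {}) \<subseteq> acl_g M {}" using mono [OF acl_bot(1) B(1)] acl_bot(2) by auto
    moreover have "f (acl_g M {}) \<in> acl_sets M" using fP acl_bot(1) by blast
    ultimately show ?thesis using acl_bot(2) by blast
  qed
  \<comment> \<open>Since \<open>f\<close> is onto, the quantifier may range over its image, where
    \<open>f\<close> can be stripped from every inclusion and equation.\<close>
  have "(\<forall>S \<in> acl_sets M. S \<subseteq> f K \<longrightarrow> S = f K \<or> S = acl_g M {}) \<longleftrightarrow>
      (\<forall>S \<in> f ` acl_sets M. S \<subseteq> f K \<longrightarrow> S = f K \<or> S = f (acl_g M {}))"
    unfolding fP bot ..
  also have "\<dots> \<longleftrightarrow> (\<forall>S \<in> acl_sets M. S \<subseteq> K \<longrightarrow> S = K \<or> S = acl_g M {})"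
    using mono inj K acl_bot(1) by simp
  finally show ?thesis
    unfolding geom_iff_atom using K imageI [OF K, of f] inj [OF K acl_bot(1)] by (simp add: fP bot)
qed

text \<open>\<open>f\<close> permutes the atoms and respects the order-theoretic description of
  closure in \<open>geom_cl_iff\<close>. The restriction to \<open>geom M\<close> supplies the
  extensionality that \<open>Bij\<close> demands.\<close>

lemma acl_order_auto_Aut_geom:
  assumes f: "acl_order_auto f"
  shows "restrict f (geom M) \<in> carrier (Aut_geom M)"
proof -
  let ?r = "restrict f (geom M)"
  have fP: "f ` acl_sets M = acl_sets M"
    and mono: "\<And>K S. \<lbrakk>K \<in> acl_sets M; S \<in> acl_sets M\<rbrakk> \<Longrightarrow> f K \<subseteq> f S \<longleftrightarrow> K \<subseteq> S"
    using f unfolding acl_order_auto_def by auto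
  note sub = subsetD [OF geom_subset_acl_sets]
  have "inj_on f (geom M)"
    using mono sub by (intro inj_onI) (metis subset_antisym order_refl)
  moreover have img: "f ` geom M = geom M"
  proof
    show "f ` geom M \<subseteq> geom M" using acl_order_auto_geom [OF f] sub by blast
    show "geom M \<subseteq> f ` geom M"
    proof
      fix K assume K: "K \<in> geom M"
      then obtain L where "L \<in> acl_sets M" "K = f L" using fP sub by blast
      then show "K \<in> f ` geom M" using acl_order_auto_geom [OF f] K by blast
    qed
  qed
  ultimately have "?r \<in> Bij (geom M)"
    by (simp add: Bij_def bij_betw_def inj_on_restrict_eq)
  moreover have "?r ` geom_cl M X = geom_cl M (?r ` X)" if X: "X \<subseteq> geom M" for X
  proof -
    have fX: "?r ` X = f ` X" "f ` X \<subseteq> geom M" using X img by auto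
    have iff: "f K \<in> geom_cl M (f ` X) \<longleftrightarrow> K \<in> geom_cl M X" if K: "K \<in> geom M" for K
    proof -
      \<comment> \<open>As \<open>f\<close> is onto, the upper bounds of the image of
        \<open>Y\<close> are exactly the images of the upper bounds of \<open>Y\<close>.\<close>
      have *: "(\<forall>S \<in> acl_sets M. (\<forall>L\<in>f ` Y. L \<subseteq> S) \<longrightarrow> f K \<subseteq> S) \<longleftrightarrow>
          (\<forall>S \<in> acl_sets M. (\<forall>L\<in>Y. L \<subseteq> S) \<longrightarrow> K \<subseteq> S)" if "Y \<subseteq> X" for Y
      proof -
        have "L \<in> acl_sets M" if "L \<in> Y" for L using that \<open>Y \<subseteq> X\<close> X sub by blast
        then show ?thesis
          using mono sub [OF K] by (subst fP [symmetric]) auto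
      qed
      have "f K \<in> geom M" using img K by blast
      then have "f K \<in> geom_cl M (f ` X) \<longleftrightarrow>
          (\<exists>Y. finite Y \<and> Y \<subseteq> f ` X \<and> (\<forall>S \<in> acl_sets M. (\<forall>L\<in>Y. L \<subseteq> S) \<longrightarrow> f K \<subseteq> S))"
        by (rule geom_cl_iff [OF fX(2)])
      also have "\<dots> \<longleftrightarrow> (\<exists>Y. finite Y \<and> Y \<subseteq> X \<and>
          (\<forall>S \<in> acl_sets M. (\<forall>L\<in>f ` Y. L \<subseteq> S) \<longrightarrow> f K \<subseteq> S))"
        by (rule ex_finite_subset_image)
      also have "\<dots> \<longleftrightarrow> K \<in> geom_cl M X"
        unfolding geom_cl_iff [OF X K] by (simp only: * cong: conj_cong)
      finally show ?thesis .
    qed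
    have "f ` geom_cl M X = geom_cl M (f ` X)"
    proof
      show "f ` geom_cl M X \<subseteq> geom_cl M (f ` X)"
        using iff subsetD [OF geom_cl_subset] by blast
      show "geom_cl M (f ` X) \<subseteq> f ` geom_cl M X"
      proof
        fix L assume L: "L \<in> geom_cl M (f ` X)"
        then have "L \<in> f ` geom M" using img subsetD [OF geom_cl_subset] by blast
        then obtain K where "K \<in> geom M" "L = f K" by blast
        then show "L \<in> f ` geom_cl M X" using iff L by blast
      qed
    qed
    moreover have "?r ` geom_cl M X = f ` geom_cl M X" by (auto simp: geom_cl_def)
    ultimately show ?thesis using fX by simp
  qed
  ultimately show ?thesis by (simp add: Aut_geom_def)
qed

section \<open>The action of topological automorphisms on closed sets and on the geometry\<close>

text \<open>The rule defining \<open>pi_map\<close>, extended from the points of the geometry to all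
  of \<open>acl_sets M\<close>, where the order arguments take place.\<close>

definition acl_action :: "((nat \<Rightarrow> nat) \<Rightarrow> (nat \<Rightarrow> nat)) \<Rightarrow> nat set \<Rightarrow> nat set" where
  "acl_action \<alpha> K = (THE K'. K' \<in> acl_sets M \<and> \<alpha> ` pw_stab M K = pw_stab M K')"

lemma acl_action_eqI:
  assumes "K' \<in> acl_sets M" "\<alpha> ` pw_stab M K = pw_stab M K'"
  shows "acl_action \<alpha> K = K'"
  unfolding acl_action_def using assms pw_stab_inject by (intro the_equality) auto

lemma acl_action:
  assumes "\<alpha> \<in> carrier (Aut_top M)" "K \<in> acl_sets M"
  shows "acl_action \<alpha> K \<in> acl_sets M" "\<alpha> ` pw_stab M K = pw_stab M (acl_action \<alpha> K)"
  using image_pw_stab [OF assms] acl_action_eqI by metis+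

lemma acl_action_mult:
  assumes "\<alpha> \<in> carrier (Aut_top M)" "\<beta> \<in> carrier (Aut_top M)" "K \<in> acl_sets M"
  shows "acl_action (\<alpha> \<otimes>\<^bsub>Aut_top M\<^esub> \<beta>) K = acl_action \<alpha> (acl_action \<beta> K)"
proof (rule acl_action_eqI)
  show "acl_action \<alpha> (acl_action \<beta> K) \<in> acl_sets M" using assms acl_action by blast
  have "pw_stab M K \<subseteq> automorphisms M" by (auto simp: pw_stab_iff)
  then show "(\<alpha> \<otimes>\<^bsub>Aut_top M\<^esub> \<beta>) ` pw_stab M K = pw_stab M (acl_action \<alpha> (acl_action \<beta> K))"
    using assms acl_action by (simp add: Aut_top_image)
qed

text \<open>An inclusion of closed sets is a reversed inclusion of their pointwise stabilizers,
  which the injective \<open>\<alpha>\<close> preserves and reflects. Surjectivity comes from the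
  action of the inverse of \<open>\<alpha>\<close>.\<close>

lemma acl_order_auto_acl_action:
  assumes \<alpha>: "\<alpha> \<in> carrier (Aut_top M)"
  shows "acl_order_auto (acl_action \<alpha>)"
  unfolding acl_order_auto_def
proof (intro conjI ballI)
  have pa: "pw_stab M K \<subseteq> automorphisms M" for K by (auto simp: pw_stab_iff)
  show "acl_action \<alpha> ` acl_sets M = acl_sets M"
  proof
    show "acl_action \<alpha> ` acl_sets M \<subseteq> acl_sets M" using acl_action [OF \<alpha>] by blast
    show "acl_sets M \<subseteq> acl_action \<alpha> ` acl_sets M"
    proof
      fix K assume K: "K \<in> acl_sets M"
      have \<beta>: "inv\<^bsub>Aut_top M\<^esub> \<alpha> \<in> carrier (Aut_top M)"
        using \<alpha> group.inv_closed [OF group_Aut_top] by blast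
      have "acl_action \<alpha> (acl_action (inv\<^bsub>Aut_top M\<^esub> \<alpha>) K) = K"
        using Aut_top_inv_image(2) [OF \<alpha> pa, of K] acl_action(2) [OF \<beta> K] K
        by (intro acl_action_eqI) simp_all
      then show "K \<in> acl_action \<alpha> ` acl_sets M"
        using acl_action(1) [OF \<beta> K] by (metis image_eqI)
    qed
  qed
  fix K S assume KS: "K \<in> acl_sets M" "S \<in> acl_sets M"
  have "acl_action \<alpha> K \<subseteq> acl_action \<alpha> S \<longleftrightarrow> \<alpha> ` pw_stab M S \<subseteq> \<alpha> ` pw_stab M K"
    using acl_action [OF \<alpha>] KS by (simp add: pw_stab_subset_iff)
  also have "\<dots> \<longleftrightarrow> pw_stab M S \<subseteq> pw_stab M K"
    using inj_on_image_subset_iff [OF Aut_topD(2) [OF \<alpha>] pa pa] .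
  also have "\<dots> \<longleftrightarrow> K \<subseteq> S" using KS by (simp add: pw_stab_subset_iff)
  finally show "acl_action \<alpha> K \<subseteq> acl_action \<alpha> S \<longleftrightarrow> K \<subseteq> S" .
qed

lemma acl_action_geom:
  assumes "\<alpha> \<in> carrier (Aut_top M)" "K \<in> geom M"
  shows "acl_action \<alpha> K \<in> geom M"
  using acl_order_auto_geom [OF acl_order_auto_acl_action [OF assms(1)]] assms(2)
    geom_subset_acl_sets by blast

text \<open>Existence holds because atoms go to atoms under \<open>acl_action \<alpha>\<close>;
  uniqueness because a closed set is determined by its pointwise stabilizer.\<close>

lemma pi_map_well_defined:
  assumes "\<alpha> \<in> carrier (Aut_top M)" "K \<in> geom M"
  shows "\<exists>!K'. K' \<in> geom M \<and> \<alpha> ` pw_stab M K = pw_stab M K'"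
proof -
  have "K \<in> acl_sets M" using assms(2) geom_subset_acl_sets by blast
  then show ?thesis
    using acl_action_geom [OF assms] acl_action(2) [OF assms(1)] acl_action_eqI
      geom_subset_acl_sets by (metis subsetD)
qed

lemma pi_map_eq:
  assumes "\<alpha> \<in> carrier (Aut_top M)"
  shows "pi_map M \<alpha> = restrict (acl_action \<alpha>) (geom M)"
  unfolding pi_map_def
proof (rule restrict_ext)
  fix K assume K: "K \<in> geom M"
  then show "(THE K'. K' \<in> geom M \<and> \<alpha> ` pw_stab M K = pw_stab M K') = acl_action \<alpha> K"
    using acl_action_geom [OF assms] acl_action(2) [OF assms] geom_subset_acl_sets
    by (intro the1_equality [OF pi_map_well_defined [OF assms]]) auto
qed

lemma pi_map_Aut_geom: "\<alpha> \<in> carrier (Aut_top M) \<Longrightarrow> pi_map M \<alpha> \<in> carrier (Aut_geom M)"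
  using acl_order_auto_Aut_geom acl_order_auto_acl_action by (simp add: pi_map_eq)

lemma pi_map_hom: "pi_map M \<in> hom (Aut_top M) (Aut_geom M)"
proof (rule homI)
  show "pi_map M \<alpha> \<in> carrier (Aut_geom M)" if "\<alpha> \<in> carrier (Aut_top M)" for \<alpha>
    using that by (rule pi_map_Aut_geom)
  fix \<alpha> \<beta> assume a: "\<alpha> \<in> carrier (Aut_top M)" "\<beta> \<in> carrier (Aut_top M)"
  have B: "pi_map M \<gamma> \<in> Bij (geom M)" if "\<gamma> \<in> carrier (Aut_top M)" for \<gamma>
    using pi_map_Aut_geom [OF that] by (simp add: Aut_geom_def)
  have ab: "\<alpha> \<otimes>\<^bsub>Aut_top M\<^esub> \<beta> \<in> carrier (Aut_top M)"
    using a group_Aut_top by (metis group.is_monoid monoid.m_closed)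
  have "pi_map M (\<alpha> \<otimes>\<^bsub>Aut_top M\<^esub> \<beta>) = compose (geom M) (pi_map M \<alpha>) (pi_map M \<beta>)"
  proof (rule Bij_eqI [OF B [OF ab] compose_Bij [OF B [OF a(1)] B [OF a(2)]]])
    fix K assume "K \<in> geom M"
    then show "pi_map M (\<alpha> \<otimes>\<^bsub>Aut_top M\<^esub> \<beta>) K = compose (geom M) (pi_map M \<alpha>) (pi_map M \<beta>) K"
      using a ab acl_action_mult [OF a] acl_action_geom geom_subset_acl_sets
      by (auto simp: pi_map_eq compose_def)
  qed
  then show "pi_map M (\<alpha> \<otimes>\<^bsub>Aut_top M\<^esub> \<beta>) = pi_map M \<alpha> \<otimes>\<^bsub>Aut_geom M\<^esub> pi_map M \<beta>"
    using B a by (simp add: Aut_geom_def BijGroup_def)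
qed

end

section \<open>The automorphisms of the canonical geometry form a group\<close>

lemma carrier_Aut_geom:
  "f \<in> carrier (Aut_geom M) \<longleftrightarrow>
     f \<in> Bij (geom M) \<and> (\<forall>X. X \<subseteq> geom M \<longrightarrow> f ` geom_cl M X = geom_cl M (f ` X))"
  by (simp add: Aut_geom_def)

lemma group_Aut_geom: "group (Aut_geom M)"
proof -
  have img: "f ` geom M = geom M" "inj_on f (geom M)" if "f \<in> Bij (geom M)" for f
    using that by (auto simp: Bij_def bij_betw_def)
  have "subgroup (carrier (Aut_geom M)) (BijGroup (geom M))"
  proof (rule group.subgroupI [OF group_BijGroup])
    show "carrier (Aut_geom M) \<subseteq> carrier (BijGroup (geom M))"
      by (auto simp: carrier_Aut_geom BijGroup_def)
    have id: "(\<lambda>x\<in>geom M. x) ` X = X" if "X \<subseteq> geom M" for X using that by force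
    have "(\<lambda>x\<in>geom M. x) \<in> carrier (Aut_geom M)"
      unfolding carrier_Aut_geom by (intro conjI allI impI id_Bij) (simp only: id geom_cl_subset)
    then show "carrier (Aut_geom M) \<noteq> {}" by blast
    fix f assume f: "f \<in> carrier (Aut_geom M)"
    then have fB: "f \<in> Bij (geom M)" by (simp add: carrier_Aut_geom)
    let ?i = "\<lambda>x\<in>geom M. inv_into (geom M) f x"
    have iB: "?i \<in> Bij (geom M)" using fB by (rule restrict_inv_into_Bij)
    have "?i ` geom_cl M X = geom_cl M (?i ` X)" if X: "X \<subseteq> geom M" for X
    proof -
      have fi: "f ` ?i ` Y = Y" if "Y \<subseteq> geom M" for Y
      proof -
        have "f (?i y) = y" if "y \<in> Y" for y
          using that \<open>Y \<subseteq> geom M\<close> img(1) [OF fB] by (auto simp: f_inv_into_f subset_iff)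
        then show ?thesis by (force simp: image_image)
      qed
      have iX: "?i ` Y \<subseteq> geom M" if "Y \<subseteq> geom M" for Y
        using that img(1) [OF iB] by blast
      \<comment> \<open>The inverse is compared with the closure operator after applying
        \<open>f\<close>, which is injective on \<open>geom M\<close> and commutes with
        closure.\<close>
      have "f ` ?i ` geom_cl M X = f ` geom_cl M (?i ` X)"
        using f iX [OF X] fi [OF X] fi [OF geom_cl_subset] by (simp add: carrier_Aut_geom)
      then show ?thesis
        by (rule iffD1 [OF inj_on_image_eq_iff [OF img(2) [OF fB] iX [OF geom_cl_subset] geom_cl_subset]])
    qed
    then show "inv\<^bsub>BijGroup (geom M)\<^esub> f \<in> carrier (Aut_geom M)"
      using iB by (simp add: inv_BijGroup [OF fB] carrier_Aut_geom)
    fix g assume g: "g \<in> carrier (Aut_geom M)"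
    then have gB: "g \<in> Bij (geom M)" by (simp add: carrier_Aut_geom)
    have c: "compose (geom M) f g ` X = f ` g ` X" if "X \<subseteq> geom M" for X
      unfolding image_image using that by (intro image_cong) (auto simp: compose_def)
    have "compose (geom M) f g ` geom_cl M X = geom_cl M (compose (geom M) f g ` X)"
      if X: "X \<subseteq> geom M" for X
    proof -
      have "g ` X \<subseteq> geom M" using X img(1) [OF gB] by blast
      then show ?thesis
        using f g X by (simp add: c geom_cl_subset carrier_Aut_geom)
    qed
    then show "f \<otimes>\<^bsub>BijGroup (geom M)\<^esub> g \<in> carrier (Aut_geom M)"
      using fB gB by (simp add: carrier_Aut_geom BijGroup_def compose_Bij)
  qed
  moreover have "Aut_geom M = (BijGroup (geom M))\<lparr>carrier := carrier (Aut_geom M)\<rparr>"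
    by (simp add: Aut_geom_def)
  ultimately show ?thesis
    using subgroup.subgroup_is_group [OF _ group_BijGroup] by metis
qed

section \<open>Conjugation by permutations\<close>

lemma gamma_map_apply:
  assumes "bij h" "x \<in> automorphisms M"
  shows "gamma_map M h x = h \<circ> x \<circ> inv_into UNIV h"
  using assms automorphisms_bij [OF assms(2)]
  by (simp add: gamma_map_def Sym_omega_inv Sym_omega_mult bij_imp_bij_inv bij_comp)

lemma gamma_map_image_pw_stab:
  assumes h: "bij h" and \<gamma>: "gamma_map M h \<in> carrier (Aut_top M)"
  shows "gamma_map M h ` pw_stab M K = pw_stab M (h ` K)"
proof -
  note hi = inv_into_UNIV_bij [OF h]
  \<comment> \<open>Because \<open>gamma_map M h\<close> maps \<open>automorphisms M\<close> onto
    itself, \<open>h\<close> normalizes it. For the backward direction, surjectivity gives an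
    automorphism \<open>y\<close> with the same conjugate as \<open>x\<close>, and cancelling
    \<open>h\<close> yields \<open>x = y\<close>.\<close>
  have "x \<in> automorphisms M \<longleftrightarrow> h \<circ> x \<circ> inv_into UNIV h \<in> automorphisms M" for x
  proof
    show "h \<circ> x \<circ> inv_into UNIV h \<in> automorphisms M" if "x \<in> automorphisms M"
      using that Aut_topD(3) [OF \<gamma>] gamma_map_apply [OF h that] by (metis image_eqI)
    assume "h \<circ> x \<circ> inv_into UNIV h \<in> automorphisms M"
    then obtain y where y: "y \<in> automorphisms M"
        "h \<circ> x \<circ> inv_into UNIV h = h \<circ> y \<circ> inv_into UNIV h"
      using Aut_topD(3) [OF \<gamma>] gamma_map_apply [OF h] by (metis imageE)
    have "x a = y a" for a
      using fun_cong [OF y(2), of "h a"] hi by (metis comp_apply)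
    then have "x = y" by blast
    then show "x \<in> automorphisms M" using y(1) by simp
  qed
  then have "(\<lambda>x. h \<circ> x \<circ> inv_into UNIV h) ` pw_stab M K = pw_stab M (h ` K)"
    by (rule pw_stab_conj [OF h])
  moreover have "gamma_map M h ` pw_stab M K = (\<lambda>x. h \<circ> x \<circ> inv_into UNIV h) ` pw_stab M K"
    by (intro image_cong refl gamma_map_apply [OF h]) (simp add: pw_stab_iff)
  ultimately show ?thesis by simp
qed

lemma gamma_map_hom:
  assumes H: "subgroup H Sym_omega" and \<gamma>: "\<And>h. h \<in> H \<Longrightarrow> gamma_map M h \<in> carrier (Aut_top M)"
  shows "gamma_map M \<in> hom (Sym_omega\<lparr>carrier := H\<rparr>) (Aut_top M)"
proof (rule homI)
  show "gamma_map M h \<in> carrier (Aut_top M)" if "h \<in> carrier (Sym_omega\<lparr>carrier := H\<rparr>)" for h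
    using that \<gamma> by simp
  fix h k
  assume "h \<in> carrier (Sym_omega\<lparr>carrier := H\<rparr>)" "k \<in> carrier (Sym_omega\<lparr>carrier := H\<rparr>)"
  then have hk: "h \<in> H" "k \<in> H" by simp_all
  have b: "bij h" "bij k"
    using hk subgroup.subset [OF H] Sym_omega_carrier by blast+
  have hkH: "h \<circ> k \<in> H"
    using subgroup.m_closed [OF H hk] by (simp add: Sym_omega_mult b)
  have "gamma_map M (h \<circ> k) = compose (automorphisms M) (gamma_map M h) (gamma_map M k)"
  proof (rule Bij_eqI [OF _ compose_Bij])
    fix x assume x: "x \<in> automorphisms M"
    then have "gamma_map M k x \<in> automorphisms M"
      using Aut_topD(3) [OF \<gamma> [OF hk(2)]] by blast
    then show "gamma_map M (h \<circ> k) x = compose (automorphisms M) (gamma_map M h) (gamma_map M k) x"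
      using x b by (simp add: compose_def gamma_map_apply bij_comp o_inv_distrib o_assoc)
  qed (use hk hkH \<gamma> in \<open>auto intro: Aut_topD(1)\<close>)
  then show "gamma_map M (h \<otimes>\<^bsub>Sym_omega\<lparr>carrier := H\<rparr>\<^esub> k) = gamma_map M h \<otimes>\<^bsub>Aut_top M\<^esub> gamma_map M k"
    using b hk \<gamma> by (simp add: Sym_omega_mult Aut_top_mult)
qed

text \<open>Conjugation by \<open>h\<close> carries the pointwise stabilizer of \<open>K\<close> to
  that of the image of \<open>K\<close> under \<open>h\<close>. The hypothesis on
  \<open>phi_map M h\<close> places this image in \<open>geom M\<close>, so it is the set singled
  out by \<open>pi_map\<close>.\<close>

lemma (in lascar_pregeometry) pi_gamma_eq_phi:
  assumes h: "bij h" and \<gamma>: "gamma_map M h \<in> carrier (Aut_top M)"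
    and \<phi>: "phi_map M h \<in> carrier (Aut_geom M)"
  shows "pi_map M (gamma_map M h) = phi_map M h"
  unfolding pi_map_eq [OF \<gamma>] phi_map_def
proof (rule restrict_ext)
  fix K assume K: "K \<in> geom M"
  have "phi_map M h \<in> geom M \<rightarrow> geom M"
    using \<phi> by (simp add: carrier_Aut_geom Bij_imp_funcset)
  then have "phi_map M h K \<in> geom M" using K by blast
  then have "h ` K \<in> geom M" using K by (simp add: phi_map_def)
  then show "acl_action (gamma_map M h) K = h ` K"
    using geom_subset_acl_sets gamma_map_image_pw_stab [OF h \<gamma>] by (intro acl_action_eqI) auto
qed

theorem theorem1p3:
  fixes M :: "('f, 'r) omega_structure"
  assumes "Lascar_property M"
    and "pregeometry UNIV (acl_g M)"
  shows "(\<forall>\<alpha> \<in> carrier (Aut_top M). \<forall>K \<in> geom M.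
            \<exists>!K'. K' \<in> geom M \<and> \<alpha> ` pw_stab M K = pw_stab M K') \<and>
         pi_map M \<in> carrier (Aut_top M) \<rightarrow> carrier (Aut_geom M) \<and>
         (\<forall>(H :: (nat \<Rightarrow> nat) set) (hat :: (nat set \<Rightarrow> nat set) \<Rightarrow> nat \<Rightarrow> nat).
            subgroup H Sym_omega \<and> carrier (Aut_str M) \<subseteq> H \<and>
            (\<forall>A \<in> acl_sets M. \<forall>h \<in> H. h ` A \<in> acl_sets M) \<and>
            phi_map M \<in> epi (Sym_omega\<lparr>carrier := H\<rparr>) (Aut_geom M) \<and>
            (\<forall>h \<in> H. gamma_map M h \<in> carrier (Aut_top M)) \<and>
            hat \<in> hom (Aut_geom M) (Sym_omega\<lparr>carrier := H\<rparr>) \<and>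
            (\<forall>g \<in> carrier (Aut_geom M). pi_map M (gamma_map M (hat g)) = g)
            \<longrightarrow>
            (\<forall>h \<in> H. (pi_map M \<circ> gamma_map M) h = phi_map M h) \<and>
            pi_map M \<in> hom (Aut_top M) (Aut_geom M) \<and>
            (let N = kernel (Aut_top M) (Aut_geom M) (pi_map M);
                 kerpi = (Aut_top M)\<lparr>carrier := N\<rparr>;
                 \<theta> = section_action (Aut_top M) N (gamma_map M \<circ> hat)
             in \<theta> \<in> hom (Aut_geom M) (AutoGroup kerpi) \<and>
                Aut_top M \<cong> semidirect_product kerpi \<theta> (Aut_geom M)))"
proof (intro conjI allI impI ballI)
  interpret lascar_pregeometry M using assms by unfold_locales
  show "\<exists>!K'. K' \<in> geom M \<and> \<alpha> ` pw_stab M K = pw_stab M K'"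
    if "\<alpha> \<in> carrier (Aut_top M)" "K \<in> geom M" for \<alpha> K
    using that by (rule pi_map_well_defined)
  show "pi_map M \<in> carrier (Aut_top M) \<rightarrow> carrier (Aut_geom M)"
    using pi_map_Aut_geom by blast
  fix H :: "(nat \<Rightarrow> nat) set" and hat :: "(nat set \<Rightarrow> nat set) \<Rightarrow> nat \<Rightarrow> nat"
  assume "subgroup H Sym_omega \<and> carrier (Aut_str M) \<subseteq> H \<and>
            (\<forall>A \<in> acl_sets M. \<forall>h \<in> H. h ` A \<in> acl_sets M) \<and>
            phi_map M \<in> epi (Sym_omega\<lparr>carrier := H\<rparr>) (Aut_geom M) \<and>
            (\<forall>h \<in> H. gamma_map M h \<in> carrier (Aut_top M)) \<and>
            hat \<in> hom (Aut_geom M) (Sym_omega\<lparr>carrier := H\<rparr>) \<and>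
            (\<forall>g \<in> carrier (Aut_geom M). pi_map M (gamma_map M (hat g)) = g)"
  then have H: "subgroup H Sym_omega"
    and \<phi>: "phi_map M \<in> hom (Sym_omega\<lparr>carrier := H\<rparr>) (Aut_geom M)"
    and \<gamma>: "\<And>h. h \<in> H \<Longrightarrow> gamma_map M h \<in> carrier (Aut_top M)"
    and hat: "hat \<in> hom (Aut_geom M) (Sym_omega\<lparr>carrier := H\<rparr>)"
    and right_inv: "\<forall>g \<in> carrier (Aut_geom M). pi_map M ((gamma_map M \<circ> hat) g) = g"
    by (auto simp: epi_def)
  show "(pi_map M \<circ> gamma_map M) h = phi_map M h" if h: "h \<in> H" for h
  proof -
    have "bij h" using h subgroup.subset [OF H] Sym_omega_carrier by blast
    moreover have "phi_map M h \<in> carrier (Aut_geom M)"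
      using hom_in_carrier [OF \<phi>] h by simp
    ultimately show ?thesis using pi_gamma_eq_phi \<gamma> h by simp
  qed
  show "pi_map M \<in> hom (Aut_top M) (Aut_geom M)" by (rule pi_map_hom)
  \<comment> \<open>Conjugation by \<open>hat g\<close> gives a homomorphic section of
    \<open>pi_map M\<close>: it composes two homomorphisms, and \<open>right_inv\<close> is the
    section identity that \<open>split_extension\<close> requires.\<close>
  have "gamma_map M \<circ> hat \<in> hom (Aut_geom M) (Aut_top M)"
    by (rule Group.hom_compose [OF hat gamma_map_hom [OF H \<gamma>]])
  note split = split_extension [OF group_Aut_top group_Aut_geom pi_map_hom this, OF right_inv]
  show "let N = kernel (Aut_top M) (Aut_geom M) (pi_map M);
                 kerpi = (Aut_top M)\<lparr>carrier := N\<rparr>;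
                 \<theta> = section_action (Aut_top M) N (gamma_map M \<circ> hat)
             in \<theta> \<in> hom (Aut_geom M) (AutoGroup kerpi) \<and>
                Aut_top M \<cong> semidirect_product kerpi \<theta> (Aut_geom M)"
    unfolding Let_def using split by blast
qed

end
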